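(* Let $G=(V,E)$ be an infinite connected graph which is roughly transitive, has polynomial growth, and satisfies the isoperimetric inequality $\mathcal{I}(c_i,d_i)$ for some $c_i>0$ and $d_i>1$. Then $p_c(G)<1$.
   Context: Graph distance is denoted $d(\cdot,\cdot)$, and $B(x,r)=\{w\in V: d(x,w)\le r\}$. Rough transitivity: for a constant $c_1\ge 1$, a map $\phi:G\to G'$ between graphs is a $c_1$-rough isometry if for all $x,y\in G$, $\frac{1}{c_1}d(x,y)-1<d(\phi(x),\phi(y))\le c_1\, d(x,y)$, and for every $y\in G'$ there is $x\in G$ with $d(\phi(x),y)\le c_1$. $G$ is $c_1$-roughly transitive if for all $x,y\in G$ there is a $c_1$-rough isometry $\phi:G\to G$ with $\phi(x)=y$; $G$ is roughly transitive if it is $c_1$-roughly transitive for some $c_1\ge 1$. Polynomial growth: there are $c_u,d_u>0$ with $|B(x,r)|\le c_u r^{d_u}$ for all $r\ge 1$, $x\in V$. $\mathcal{I}(c_i,d_i)$: for every finite $A\subseteq V$, $|\partial A|\ge c_i|A|^{(d_i-1)/d_i}$, where $\partial A=\{\{x,y\}\in E: x\in A,\ y\notin A\}$ is the edge boundary. Bernoulli (site) percolation: each vertex is independently open with probability $p$ and closed otherwise; $\mathbb{G}_p$ is the random subgraph of $G$ induced by the open vertices, and $p_c(G)=\sup\{p\in[0,1]: \mathbb{P}[\text{there exists an infinite cluster (connected component) in }\mathbb{G}_p]=0\}$. *)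

theory Defs
  imports "HOL-Probability.Probability"
begin

text \<open>
  A graph is given by its vertex set \<open>V\<close> and its set \<open>E\<close> of edges, which are unordered pairs
  of distinct vertices. Both sets may be infinite.
\<close>

locale simple_graph =
  fixes V :: "'a set" and E :: "'a set set"
  assumes edges: "e \<in> E \<Longrightarrow> e \<subseteq> V \<and> card e = 2"

definition adj :: "'a set set \<Rightarrow> 'a rel" where
  "adj E = {(x, y). {x, y} \<in> E}"

definition connected_graph :: "'a set \<Rightarrow> 'a set set \<Rightarrow> bool" where
  "connected_graph V E \<longleftrightarrow> (\<forall>x\<in>V. \<forall>y\<in>V. (x, y) \<in> (adj E)\<^sup>*)"

text \<open>
  The distance and the balls are only meaningful in connected graphs: between vertices of
  different components the distance is an unspecified natural number.
\<close>

definition graph_dist :: "'a set set \<Rightarrow> 'a \<Rightarrow> 'a \<Rightarrow> nat" where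
  "graph_dist E x y = (LEAST n. (x, y) \<in> adj E ^^ n)"

definition graph_ball :: "'a set \<Rightarrow> 'a set set \<Rightarrow> 'a \<Rightarrow> real \<Rightarrow> 'a set" where
  "graph_ball V E x r = {w \<in> V. real (graph_dist E x w) \<le> r}"

definition rough_isometry ::
  "real \<Rightarrow> 'a set \<Rightarrow> 'a set set \<Rightarrow> 'b set \<Rightarrow> 'b set set \<Rightarrow> ('a \<Rightarrow> 'b) \<Rightarrow> bool" where
  "rough_isometry c V E V' E' \<phi> \<longleftrightarrow>
     \<phi> \<in> V \<rightarrow> V' \<and>
     (\<forall>x\<in>V. \<forall>y\<in>V.
        1 / c * real (graph_dist E x y) - 1 < real (graph_dist E' (\<phi> x) (\<phi> y)) \<and>
        real (graph_dist E' (\<phi> x) (\<phi> y)) \<le> c * real (graph_dist E x y)) \<and>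
     (\<forall>y\<in>V'. \<exists>x\<in>V. real (graph_dist E' (\<phi> x) y) \<le> c)"

definition roughly_transitive_with :: "real \<Rightarrow> 'a set \<Rightarrow> 'a set set \<Rightarrow> bool" where
  "roughly_transitive_with c V E \<longleftrightarrow>
     (\<forall>x\<in>V. \<forall>y\<in>V. \<exists>\<phi>. rough_isometry c V E V E \<phi> \<and> \<phi> x = y)"

definition roughly_transitive :: "'a set \<Rightarrow> 'a set set \<Rightarrow> bool" where
  "roughly_transitive V E \<longleftrightarrow> (\<exists>c\<ge>1. roughly_transitive_with c V E)"

text \<open>Finiteness of the balls is explicit because \<^const>\<open>card\<close> is \<open>0\<close> on infinite sets.\<close>

definition polynomial_growth :: "'a set \<Rightarrow> 'a set set \<Rightarrow> bool" where
  "polynomial_growth V E \<longleftrightarrow>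
     (\<exists>c d. c > 0 \<and> d > 0 \<and>
        (\<forall>x\<in>V. \<forall>r\<ge>1. finite (graph_ball V E x r) \<and>
           real (card (graph_ball V E x r)) \<le> c * r powr d))"

definition edge_boundary :: "'a set set \<Rightarrow> 'a set \<Rightarrow> 'a set set" where
  "edge_boundary E A = {{x, y} | x y. {x, y} \<in> E \<and> x \<in> A \<and> y \<notin> A}"

text \<open>
  An infinite boundary (possible only if the graph is not locally finite) satisfies the
  inequality.
\<close>

definition isoperimetric :: "'a set \<Rightarrow> 'a set set \<Rightarrow> real \<Rightarrow> real \<Rightarrow> bool" where
  "isoperimetric V E c d \<longleftrightarrow>
     (\<forall>A. finite A \<and> A \<subseteq> V \<longrightarrow>
        infinite (edge_boundary E A) \<or>
        real (card (edge_boundary E A)) \<ge> c * real (card A) powr ((d - 1) / d))"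

definition induced_edges :: "'a set set \<Rightarrow> 'a set \<Rightarrow> 'a set set" where
  "induced_edges E W = {e \<in> E. e \<subseteq> W}"

definition components_of :: "'a set \<Rightarrow> 'a set set \<Rightarrow> 'a set set" where
  "components_of V E = {{y \<in> V. (x, y) \<in> (adj E)\<^sup>*} | x. x \<in> V}"

text \<open>A configuration \<open>\<omega>\<close> maps each vertex to \<open>True\<close> (open) or \<open>False\<close> (closed).\<close>

definition site_percolation :: "'a set \<Rightarrow> real \<Rightarrow> ('a \<Rightarrow> bool) measure" where
  "site_percolation V p = (\<Pi>\<^sub>M x\<in>V. measure_pmf (bernoulli_pmf p))"

definition open_vertices :: "'a set \<Rightarrow> ('a \<Rightarrow> bool) \<Rightarrow> 'a set" where
  "open_vertices V \<omega> = {x \<in> V. \<omega> x}"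

definition clusters :: "'a set \<Rightarrow> 'a set set \<Rightarrow> ('a \<Rightarrow> bool) \<Rightarrow> 'a set set" where
  "clusters V E \<omega> = components_of (open_vertices V \<omega>) (induced_edges E (open_vertices V \<omega>))"

definition infinite_cluster_event :: "'a set \<Rightarrow> 'a set set \<Rightarrow> real \<Rightarrow> ('a \<Rightarrow> bool) set" where
  "infinite_cluster_event V E p =
     {\<omega> \<in> space (site_percolation V p). \<exists>C \<in> clusters V E \<omega>. infinite C}"

definition critical_prob :: "'a set \<Rightarrow> 'a set set \<Rightarrow> real" where
  "critical_prob V E =
     Sup {p \<in> {0..1}. measure (site_percolation V p) (infinite_cluster_event V E p) = 0}"

text \<open>
  Since \<^const>\<open>measure\<close> is \<open>0\<close> on non-measurable sets, the definition of
  \<^const>\<open>critical_prob\<close> relies on the event being measurable. This holds whenever \<open>V\<close> is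
  countable, which is the case for every connected graph of polynomial growth.
\<close>

lemma connected_polynomial_growth_countable:
  assumes "connected_graph V E" "polynomial_growth V E"
  shows "countable V"
proof (cases "V = {}")
  case False
  then obtain x where x: "x \<in> V" by blast
  from assms(2) x have fin: "finite (graph_ball V E x r)" if "r \<ge> 1" for r
    using that unfolding polynomial_growth_def by blast
  have "V \<subseteq> (\<Union>n::nat. graph_ball V E x (real (Suc n)))"
  proof
    fix y assume "y \<in> V"
    then have "y \<in> graph_ball V E x (real (Suc (graph_dist E x y)))"
      by (simp add: graph_ball_def)
    then show "y \<in> (\<Union>n::nat. graph_ball V E x (real (Suc n)))" by blast
  qed
  moreover have "countable (\<Union>n::nat. graph_ball V E x (real (Suc n)))"
    by (rule countable_UN) (simp_all add: countable_finite fin)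
  ultimately show ?thesis by (rule countable_subset)
qed simp

lemma infinite_cluster_event_measurable:
  assumes V: "countable V"
  shows "infinite_cluster_event V E p \<in> sets (site_percolation V p)"
proof -
  let ?M = "site_percolation V p"
  let ?R = "\<lambda>\<omega>. adj (induced_edges E (open_vertices V \<omega>))"
  have M_op: "Measurable.pred ?M (\<lambda>\<omega>. \<omega> x)" if "x \<in> V" for x
  proof -
    have "(\<lambda>\<omega>. \<omega> x) \<in> measurable ?M (measure_pmf (bernoulli_pmf p))"
      unfolding site_percolation_def by (rule measurable_component_singleton[OF that])
    then show ?thesis by simp
  qed
  have M_pow: "Measurable.pred ?M (\<lambda>\<omega>. (x, y) \<in> ?R \<omega> ^^ n)" if "x \<in> V" "y \<in> V" for x y n
    using that
  proof (induction n arbitrary: y)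
    case 0
    then show ?case by simp
  next
    case (Suc n)
    have "(x, y) \<in> ?R \<omega> ^^ Suc n \<longleftrightarrow>
       (\<exists>z\<in>V. (x, z) \<in> ?R \<omega> ^^ n \<and> {z, y} \<in> E \<and> \<omega> z \<and> \<omega> y)" for \<omega>
    proof -
      have "(z, y) \<in> ?R \<omega> \<longleftrightarrow> {z, y} \<in> E \<and> z \<in> V \<and> \<omega> z \<and> \<omega> y" for z
        using Suc.prems by (auto simp: adj_def induced_edges_def open_vertices_def)
      then show ?thesis
        unfolding relpow.simps relcomp_unfold by blast
    qed
    moreover have "Measurable.pred ?M
       (\<lambda>\<omega>. \<exists>z\<in>V. (x, z) \<in> ?R \<omega> ^^ n \<and> {z, y} \<in> E \<and> \<omega> z \<and> \<omega> y)"
    proof (rule measurable_pred_countable(2)[OF V])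
      fix z assume z: "z \<in> V"
      show "Measurable.pred ?M (\<lambda>\<omega>. (x, z) \<in> ?R \<omega> ^^ n \<and> {z, y} \<in> E \<and> \<omega> z \<and> \<omega> y)"
        by (intro pred_intros_logic(3) pred_intros_conj1' Suc.IH M_op z Suc.prems)
    qed
    ultimately show ?case by simp
  qed
  have inf: "infinite C \<longleftrightarrow> (\<forall>n. \<exists>y\<in>V. y \<in> C \<and> to_nat_on V y \<ge> n)" if "C \<subseteq> V" for C
  proof -
    have "inj_on (to_nat_on V) C"
      using V that inj_on_subset inj_on_to_nat_on by blast
    then have "infinite C \<longleftrightarrow> infinite (to_nat_on V ` C)"
      by (simp add: finite_image_iff)
    also have "\<dots> \<longleftrightarrow> (\<forall>n. \<exists>y\<in>V. y \<in> C \<and> to_nat_on V y \<ge> n)"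
      using that unfolding infinite_nat_iff_unbounded_le image_iff by blast
    finally show ?thesis .
  qed
  have "(\<exists>C \<in> clusters V E \<omega>. infinite C) \<longleftrightarrow>
     (\<exists>x\<in>V. \<omega> x \<and> (\<forall>m. \<exists>y\<in>V. (\<omega> y \<and> (\<exists>n. (x, y) \<in> ?R \<omega> ^^ n)) \<and> to_nat_on V y \<ge> m))" for \<omega>
  proof -
    have "(\<exists>C \<in> clusters V E \<omega>. infinite C) \<longleftrightarrow>
      (\<exists>x\<in>V. \<omega> x \<and> infinite {y\<in>V. \<omega> y \<and> (\<exists>n. (x, y) \<in> ?R \<omega> ^^ n)})"
      by (auto simp: clusters_def components_of_def rtrancl_power open_vertices_def conj_assoc)
    also have "\<dots> \<longleftrightarrow> (\<exists>x\<in>V. \<omega> x \<and>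
      (\<forall>m. \<exists>y\<in>V. (\<omega> y \<and> (\<exists>n. (x, y) \<in> ?R \<omega> ^^ n)) \<and> to_nat_on V y \<ge> m))"
      by (subst inf) (simp_all add: conj_assoc)
    finally show ?thesis .
  qed
  moreover have "Measurable.pred ?M (\<lambda>\<omega>.
     \<exists>x\<in>V. \<omega> x \<and> (\<forall>m. \<exists>y\<in>V. (\<omega> y \<and> (\<exists>n. (x, y) \<in> ?R \<omega> ^^ n)) \<and> to_nat_on V y \<ge> m))"
    by (intro measurable_pred_countable(2)[OF V] pred_intros_logic(3) pred_intros_conj2'
        pred_intros_countable M_op M_pow)
  ultimately show ?thesis
    unfolding infinite_cluster_event_def by (simp add: pred_def)
qed

end

theory Submission
  imports Defs
begin

text \<open>
  Multiscale renormalization. For vertices well outside a ball of radius \<open>r\<close> but within a constant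
  multiple of \<open>r\<close> of its centre, there is a detour around the ball of length scale only about
  \<open>r log r\<close>. Otherwise rough transitivity makes every ball of comparable radius a local cut. If some
  ball cuts off three arms, then all do and the graph contains binary trees of depth of order
  \<open>log r\<close>, against polynomial growth; if all cut off exactly two, the graph is a line of balls,
  whose segments have bounded boundary, against the isoperimetric inequality.

  At level \<open>k\<close> call a vertex bad if two level-\<open>(k - 1)\<close> bad vertices within distance \<open>R k\<close> of it are
  more than \<open>4 * R (k - 1)\<close> apart. A bad vertex forces \<open>2 ^ k\<close> closed vertices chosen from a family
  whose size is only exponential in \<open>2 ^ k\<close>, so that for \<open>p\<close> near 1, with positive probability, there are no
  level-\<open>k\<close> bad vertices within a multiple of \<open>R k\<close> of a fixed vertex, for all \<open>k\<close>. The detours then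
  turn, level by level, a long path avoiding the level-\<open>k\<close> bad vertices into an open path.
\<close>

section \<open>Paths in large graphs and rough isometries\<close>

text \<open>Two obstacles shape the argument. A vertex just beyond a ball may lie in a finite pocket
  behind it, so connectivity of an annulus can only be claimed for vertices deeper than
  \<open>\<kappa> * r\<close>; every later detour has to start and end at such vertices. Moreover,
  rough isometries are not automorphisms: a path pulls back only up to a bounded error, so
  separation inside an annulus survives a transfer only with a larger inner and a smaller outer
  radius. Separation statements therefore carry an explicit outer radius, and the one fixed at the
  start leaves room for two transfers and for \<open>n + 1\<close> generations of branching. The
  logarithm comes from choosing \<open>n\<close> so that \<open>2 ^ n\<close> exceeds the volume of
  a ball of radius about \<open>n * r\<close>. As detours are longer than any constant multiple of
  \<open>r\<close>, geometrically growing scales would leave no room for them.\<close>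

definition joined :: "'a set set \<Rightarrow> 'a set \<Rightarrow> 'a \<Rightarrow> 'a \<Rightarrow> bool" where
  "joined E W a b \<longleftrightarrow> a \<in> W \<and> (a, b) \<in> (adj (induced_edges E W))\<^sup>*"

lemma joined_refl: "a \<in> W \<Longrightarrow> joined E W a a"
  by (simp add: joined_def)

lemma joined_step:
  assumes "joined E W a b" "{b, c} \<in> E" "c \<in> W"
  shows "joined E W a c"
proof -
  have "b \<in> W"
    using assms(1) unfolding joined_def
    by (auto elim!: rtranclE simp: adj_def induced_edges_def)
  then have "(b, c) \<in> adj (induced_edges E W)"
    using assms by (simp add: adj_def induced_edges_def)
  then show ?thesis
    using assms(1) unfolding joined_def by auto
qed

lemma joined_induct [consumes 1, case_names refl step]:
  assumes "joined E W a b"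
    and "a \<in> W \<Longrightarrow> P a"
    and "\<And>b c. joined E W a b \<Longrightarrow> P b \<Longrightarrow> b \<in> W \<Longrightarrow> {b, c} \<in> E \<Longrightarrow> c \<in> W \<Longrightarrow> P c"
  shows "P b"
proof -
  have a: "a \<in> W" and "(a, b) \<in> (adj (induced_edges E W))\<^sup>*"
    using assms(1) by (auto simp: joined_def)
  from this(2) show ?thesis
  proof (induction rule: rtrancl_induct)
    case base
    show ?case using assms(2) a .
  next
    case (step y z)
    then show ?case
      using assms(3)[of y z] a by (auto simp: joined_def adj_def induced_edges_def)
  qed
qed

text \<open>Reflexivity of the closure would join every vertex to itself; the clause
  \<open>a \<in> W\<close> in \<open>joined\<close> excludes this. Thus \<open>joined E W\<close> is
  an equivalence relation on \<open>W\<close>, and its failure may also mean that an endpoint lies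
  outside \<open>W\<close>.\<close>

lemma joined_in:
  assumes "joined E W a b"
  shows "a \<in> W" "b \<in> W"
proof -
  show "a \<in> W" using assms by (simp add: joined_def)
  show "b \<in> W" using assms by (induction rule: joined_induct) auto
qed

lemma joined_trans: "joined E W a b \<Longrightarrow> joined E W b c \<Longrightarrow> joined E W a c"
  unfolding joined_def by auto

lemma joined_sym:
  assumes "joined E W a b"
  shows "joined E W b a"
  using assms
proof (induction rule: joined_induct)
  case refl
  then show ?case by (rule joined_refl)
next
  case (step b c)
  have "joined E W c b"
    using step by (intro joined_step[OF joined_refl]) (auto simp: insert_commute)
  then show ?case using step.IH by (rule joined_trans)
qed

lemma joined_common: "joined E W a w \<Longrightarrow> joined E W b w \<Longrightarrow> joined E W a b"
  by (rule joined_trans[OF _ joined_sym])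

lemma joined_mono:
  assumes "joined E W a b" "W \<subseteq> W'"
  shows "joined E W' a b"
  using assms(1)
proof (induction rule: joined_induct)
  case refl
  then show ?case using assms(2) by (auto intro: joined_refl)
next
  case (step b c)
  then show ?case using assms(2) by (auto intro: joined_step)
qed

locale inf_graph = simple_graph V E for V :: "'a set" and E +
  assumes conn: "connected_graph V E"
    and infV: "infinite V"
begin

abbreviation d :: "'a \<Rightarrow> 'a \<Rightarrow> nat" where
  "d \<equiv> graph_dist E"

abbreviation gball :: "'a \<Rightarrow> nat \<Rightarrow> 'a set" where
  "gball y r \<equiv> {w \<in> V. d y w \<le> r}"

abbreviation outside :: "'a \<Rightarrow> nat \<Rightarrow> 'a set" where
  "outside y r \<equiv> {w \<in> V. r < d y w}"

abbreviation ann :: "'a \<Rightarrow> nat \<Rightarrow> nat \<Rightarrow> 'a set" where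
  "ann y r s \<equiv> {w \<in> V. r < d y w \<and> d y w \<le> s}"

lemma edge_V: "{x, y} \<in> E \<Longrightarrow> x \<in> V \<and> y \<in> V"
  using edges by blast

lemma sym_adj: "sym (adj E)"
  by (auto simp: sym_def adj_def insert_commute)

lemma dist_relpow:
  assumes "x \<in> V" "y \<in> V"
  shows "(x, y) \<in> adj E ^^ d x y"
proof -
  obtain n where "(x, y) \<in> adj E ^^ n"
    using conn assms unfolding connected_graph_def by (blast dest: rtrancl_imp_relpow)
  then show ?thesis unfolding graph_dist_def by (rule LeastI)
qed

lemma dist_le: "(x, y) \<in> adj E ^^ n \<Longrightarrow> d x y \<le> n"
  unfolding graph_dist_def by (rule Least_le)

lemma dist_self [simp]: "d x x = 0"
  using dist_le[of x x 0] by simp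

lemma dist_eq_0: "x \<in> V \<Longrightarrow> y \<in> V \<Longrightarrow> d x y = 0 \<longleftrightarrow> x = y"
  using dist_relpow[of x y] by auto

lemma relpow_adj_sym: "(x, y) \<in> adj E ^^ n \<Longrightarrow> (y, x) \<in> adj E ^^ n"
proof (induction n arbitrary: y)
  case 0
  then show ?case by simp
next
  case (Suc n)
  then obtain z where z: "(x, z) \<in> adj E ^^ n" "(z, y) \<in> adj E" by auto
  then have "(y, z) \<in> adj E" using sym_adj by (meson symE)
  with Suc.IH[OF z(1)] show ?case by (rule relpow_Suc_I2[rotated])
qed

lemma dist_sym: "d x y = d y x"
proof -
  have "(x, y) \<in> adj E ^^ n \<longleftrightarrow> (y, x) \<in> adj E ^^ n" for n
    using relpow_adj_sym by blast
  then show ?thesis by (simp add: graph_dist_def)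
qed

lemma dist_triangle:
  assumes "x \<in> V" "y \<in> V" "z \<in> V"
  shows "d x z \<le> d x y + d y z"
proof (rule dist_le)
  show "(x, z) \<in> adj E ^^ (d x y + d y z)"
    using dist_relpow[OF assms(1,2)] dist_relpow[OF assms(2,3)]
    unfolding relpow_add by blast
qed

lemma dist_edge: "{x, y} \<in> E \<Longrightarrow> d x y \<le> 1"
  by (rule dist_le) (simp add: adj_def)

lemma dist_edge_le:
  assumes "z \<in> V" "{x, y} \<in> E"
  shows "d z y \<le> d z x + 1"
proof -
  have "d z y \<le> d z x + d x y"
    using assms edge_V by (intro dist_triangle) auto
  then show ?thesis using dist_edge[OF assms(2)] by linarith
qed

text \<open>The set is the metric interval, the vertices on geodesics from \<open>u\<close> to
  \<open>v\<close>. It stands in for a chosen geodesic, whose distance identity is all that later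
  estimates use.\<close>

lemma joined_interval:
  assumes "u \<in> V" "v \<in> V"
  shows "joined E {t \<in> V. d u t + d t v = d u v} u v"
  using assms(1)
proof (induction "d u v" arbitrary: u)
  case 0
  then have "u = v" using assms(2) dist_eq_0 by auto
  then show ?case using assms(2) by (auto intro: joined_refl)
next
  case (Suc n)
  have "(u, v) \<in> adj E ^^ Suc n"
    using dist_relpow[OF \<open>u \<in> V\<close> assms(2)] Suc(2) by simp
  then obtain t where t: "(u, t) \<in> adj E" "(t, v) \<in> adj E ^^ n"
    by (rule relpow_Suc_E2)
  have ut: "{u, t} \<in> E" "t \<in> V" using t(1) edge_V by (auto simp: adj_def)
  have 1: "d u t \<le> 1" using ut(1) by (rule dist_edge)
  have "d t v \<le> n" using t(2) by (rule dist_le)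
  moreover have tri: "d u v \<le> d u t + d t v"
    using ut assms(2) Suc by (intro dist_triangle) auto
  ultimately have n: "n = d t v" "d u t = 1" using 1 Suc(2) by linarith+
  have "joined E {w \<in> V. d t w + d w v = d t v} t v"
    by (rule Suc.hyps(1)[OF n(1) ut(2)])
  moreover have "{w \<in> V. d t w + d w v = d t v} \<subseteq> {w \<in> V. d u w + d w v = d u v}"
  proof
    fix w assume w: "w \<in> {w \<in> V. d t w + d w v = d t v}"
    have "d u w \<le> d u t + d t w" "d u v \<le> d u w + d w v"
      using w ut assms(2) Suc.prems by (auto intro: dist_triangle)
    then show "w \<in> {w \<in> V. d u w + d w v = d u v}"
      using w n Suc(2) by auto
  qed
  ultimately have tv: "joined E {w \<in> V. d u w + d w v = d u v} t v" by (rule joined_mono)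
  have "joined E {w \<in> V. d u w + d w v = d u v} u t"
  proof (rule joined_step[OF joined_refl _ ])
    show "u \<in> {w \<in> V. d u w + d w v = d u v}" using Suc.prems by simp
    show "{u, t} \<in> E" by fact
    show "t \<in> {w \<in> V. d u w + d w v = d u v}" using ut(2) n Suc(2) by simp
  qed
  from this tv show ?case by (rule joined_trans)
qed

lemma joined_gball:
  assumes "y \<in> V" "w \<in> gball y r"
  shows "joined E (gball y r) w y"
proof (rule joined_sym, rule joined_mono)
  show "joined E {t \<in> V. d y t + d t w = d y w} y w"
    using assms by (intro joined_interval) auto
qed (use assms in auto)

text \<open>Along an edge the distance to \<open>z\<close> changes by at most 1, so a path cannot
  jump over the value \<open>h\<close>; it is stopped where it takes that value.\<close>

lemma joined_ivt:
  assumes "joined E W a b" "W \<subseteq> V" "z \<in> V" "d z a \<le> h" "h \<le> d z b"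
  obtains b' where "d z b' = h" "joined E {w \<in> W. d z w \<le> h} a b'"
proof -
  let ?W = "{w \<in> W. d z w \<le> h}"
  have "joined E ?W a b \<or> (\<exists>b'. d z b' = h \<and> joined E ?W a b')"
    using assms(1)
  proof (induction rule: joined_induct)
    case refl
    then show ?case using assms by (auto intro: joined_refl)
  next
    case (step b c)
    show ?case
    proof (cases "\<exists>b'. d z b' = h \<and> joined E ?W a b'")
      case False
      then have b: "joined E ?W a b" "d z b \<noteq> h" using step.IH by auto
      from joined_in(2)[OF b(1)] have "d z b \<le> h" by simp
      moreover have "d z c \<le> d z b + 1"
        using assms(3) \<open>{b, c} \<in> E\<close> by (rule dist_edge_le)
      ultimately have "c \<in> ?W" using b(2) \<open>c \<in> W\<close> by simp
      then show ?thesis using joined_step[OF b(1) \<open>{b, c} \<in> E\<close>] by blast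
    qed blast
  qed
  moreover have "d z b = h" if "joined E ?W a b"
    using joined_in(2)[OF that] assms(5) by simp
  ultimately show thesis using that by blast
qed

text \<open>If a geodesic from \<open>v\<close> to \<open>x\<close> met the \<open>r\<close>-ball at
  \<open>y\<close> in \<open>t\<close>, its part up to \<open>t\<close>, nowhere closer to
  \<open>x\<close> than \<open>t\<close> is, followed by a path inside that ball would join
  \<open>v\<close> to \<open>y\<close> within \<open>W\<close>. Hence a vertex that the ball at
  \<open>x\<close> cuts off from \<open>y\<close> reaches \<open>x\<close> without coming near
  \<open>y\<close>. This exchange of roles between two disjoint balls drives the pocket, branching
  and chain arguments.\<close>

lemma joined_toward:
  assumes V: "v \<in> V" "x \<in> V" "y \<in> V"
    and far: "\<And>t. t \<in> V \<Longrightarrow> d y t \<le> r \<Longrightarrow> \<rho> < d x t"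
    and nj: "\<not> joined E W v y"
    and W: "{t \<in> V. \<rho> < d x t \<and> (d x t \<le> d x v \<or> d y t \<le> r)} \<subseteq> W"
  shows "joined E {t \<in> V. r < d y t \<and> d x t \<le> d x v} v x"
proof (rule joined_mono[OF joined_interval[OF V(1,2)]], rule subsetI)
  fix t assume t: "t \<in> {t \<in> V. d v t + d t x = d v x}"
  have "r < d y t"
  proof (rule ccontr)
    assume "\<not> r < d y t"
    then have yt: "d y t \<le> r" by simp
    have "joined E W v t"
    proof (rule joined_mono[OF joined_interval[OF V(1)]])
      show "t \<in> V" using t by simp
      have "s \<in> W" if s: "s \<in> V" "d v s + d s t = d v t" for s
      proof -
        have "d v x \<le> d v s + d s x" "d s x \<le> d s t + d t x"
          using V s t by (auto intro: dist_triangle)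
        then have "d t x \<le> d s x" "d s x \<le> d v x" using s t by auto
        moreover have "\<rho> < d x t" using far t yt by simp
        ultimately show ?thesis using W s(1) by (auto simp: dist_sym)
      qed
      then show "{s \<in> V. d v s + d s t = d v t} \<subseteq> W" by blast
    qed
    moreover have "joined E W t y"
    proof (rule joined_mono[OF joined_gball[OF V(3)]])
      show "t \<in> gball y r" using t yt by simp
      show "gball y r \<subseteq> W" using W far by blast
    qed
    ultimately have "joined E W v y" by (rule joined_trans)
    then show False using nj by simp
  qed
  then show "t \<in> {t \<in> V. r < d y t \<and> d x t \<le> d x v}"
    using t by (simp add: dist_sym)
qed

text \<open>The lower bound of a rough isometry is multiplied by \<open>c\<close>, taken to be a
  natural number, so that distance estimates stay in the natural numbers.\<close>

definition rough_map :: "nat \<Rightarrow> ('a \<Rightarrow> 'a) \<Rightarrow> bool" where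
  "rough_map c \<phi> \<longleftrightarrow> \<phi> \<in> V \<rightarrow> V \<and>
     (\<forall>a\<in>V. \<forall>b\<in>V. d a b < c * (d (\<phi> a) (\<phi> b) + 1) \<and> d (\<phi> a) (\<phi> b) \<le> c * d a b) \<and>
     (\<forall>y\<in>V. \<exists>x\<in>V. d (\<phi> x) y \<le> c)"

end

section \<open>Pulling back along rough isometries; finite pockets behind balls\<close>

locale rough_graph = inf_graph +
  fixes c :: nat
  assumes c_pos: "c \<ge> 1"
    and rough: "x \<in> V \<Longrightarrow> y \<in> V \<Longrightarrow> \<exists>\<phi>. rough_map c \<phi> \<and> \<phi> x = y"
    and finite_gball: "x \<in> V \<Longrightarrow> finite (gball x r)"
begin

text \<open>A path in the target of a \<open>c\<close>-rough isometry pulls back to a path whose image stays within \<open>q\<close>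
  of it; hence the outside of a ball of radius \<open>m * r\<close> pulls back to the outside of a ball of
  radius \<open>r\<close>, for \<open>r \<ge> 1\<close>. Pockets behind a ball of radius \<open>r\<close> have depth at most \<open>\<kappa> * r\<close>.\<close>

definition q :: nat where "q = c + c * (c * (2 * c + 2))"
definition m :: nat where "m = c + q"
definition \<kappa> :: nat where "\<kappa> = c * (2 * m + 1) + m + 1"

lemma far_vertex:
  assumes "x \<in> V" "infinite P" "P \<subseteq> V"
  obtains w where "w \<in> P" "d x w > n"
proof -
  have "\<not> P \<subseteq> gball x n"
    using finite_gball[OF assms(1)] assms(2) finite_subset by blast
  then show ?thesis using that assms(3) by force
qed

lemma rough_mapD:
  assumes "rough_map c \<phi>"
  shows "a \<in> V \<Longrightarrow> \<phi> a \<in> V"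
    and "a \<in> V \<Longrightarrow> b \<in> V \<Longrightarrow> d a b < c * (d (\<phi> a) (\<phi> b) + 1)"
    and "a \<in> V \<Longrightarrow> b \<in> V \<Longrightarrow> d (\<phi> a) (\<phi> b) \<le> c * d a b"
    and "y \<in> V \<Longrightarrow> \<exists>x\<in>V. d (\<phi> x) y \<le> c"
  using assms by (auto simp: rough_map_def)

text \<open>This is the origin of \<open>q\<close>. The images of \<open>x\<close> and
  \<open>x'\<close> are at most \<open>2 * c + 1\<close> apart, so \<open>x\<close> and
  \<open>x'\<close> are less than \<open>c * (2 * c + 2)\<close> apart; the image of a geodesic
  between them stays within \<open>c * (c * (2 * c + 2))\<close> of \<open>\<phi> x\<close>, which
  is within \<open>c\<close> of \<open>w\<close>.\<close>

lemma pull_back_near: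
  assumes rm: "rough_map c \<phi>" and V: "x \<in> V" "x' \<in> V" "w \<in> V" and w: "w \<in> W"
    and near: "d (\<phi> x) w \<le> c" "d w (\<phi> x') \<le> c + 1"
  shows "joined E {v \<in> V. \<exists>w\<in>W. d (\<phi> v) w \<le> q} x x'"
proof (rule joined_mono[OF joined_interval[OF V(1,2)]], rule subsetI)
  fix t assume t: "t \<in> {t \<in> V. d x t + d t x' = d x x'}"
  note rmD = rough_mapD[OF rm]
  have "d (\<phi> x) (\<phi> x') \<le> d (\<phi> x) w + d w (\<phi> x')"
    using V rmD by (intro dist_triangle) auto
  then have *: "d (\<phi> x) (\<phi> x') + 1 \<le> 2 * c + 2" using near by linarith
  have "d x x' < c * (d (\<phi> x) (\<phi> x') + 1)" using V by (intro rmD)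
  also have "\<dots> \<le> c * (2 * c + 2)" using * by (rule mult_le_mono2)
  finally have "d t x \<le> c * (2 * c + 2)" using t by (simp add: dist_sym)
  then have "c * d t x \<le> c * (c * (2 * c + 2))" by (rule mult_le_mono2)
  moreover have "d (\<phi> t) w \<le> d (\<phi> t) (\<phi> x) + d (\<phi> x) w"
    using V t rmD by (intro dist_triangle) auto
  moreover have "d (\<phi> t) (\<phi> x) \<le> c * d t x" using V t rmD by auto
  ultimately have "d (\<phi> t) w \<le> q" using near unfolding q_def by linarith
  then show "t \<in> {v \<in> V. \<exists>w\<in>W. d (\<phi> v) w \<le> q}" using t w by auto
qed

text \<open>A rough isometry is onto only up to distance \<open>c\<close>. Each path vertex is
  replaced by a vertex with image within \<open>c\<close> of it, and consecutive choices are bridged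
  by \<open>pull_back_near\<close>; its slack \<open>c + 1\<close> is \<open>c\<close> for the new
  choice plus 1 for the edge.\<close>

lemma pull_back:
  assumes rm: "rough_map c \<phi>" and a: "a \<in> V" and W: "W \<subseteq> V"
    and j: "joined E W (\<phi> a) w"
  shows "\<exists>x\<in>V. d (\<phi> x) w \<le> c \<and> joined E {v \<in> V. \<exists>w\<in>W. d (\<phi> v) w \<le> q} a x"
  using j
proof (induction rule: joined_induct)
  case refl
  have "joined E {v \<in> V. \<exists>w\<in>W. d (\<phi> v) w \<le> q} a a"
    using refl a by (intro joined_refl) (auto intro!: bexI[of _ "\<phi> a"])
  then show ?case using a by (intro bexI[of _ a]) auto
next
  case (step b e)
  then obtain x where x: "x \<in> V" "d (\<phi> x) b \<le> c"
      "joined E {v \<in> V. \<exists>w\<in>W. d (\<phi> v) w \<le> q} a x"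
    by blast
  have be: "b \<in> V" "e \<in> V" using step W by auto
  obtain x' where x': "x' \<in> V" "d (\<phi> x') e \<le> c" using rough_mapD(4)[OF rm be(2)] by blast
  have "d b (\<phi> x') \<le> d b e + d e (\<phi> x')"
    using be x' rough_mapD[OF rm] by (intro dist_triangle) auto
  then have "d b (\<phi> x') \<le> c + 1"
    using dist_edge[OF \<open>{b, e} \<in> E\<close>] x'(2) by (simp add: dist_sym)
  then have "joined E {v \<in> V. \<exists>w\<in>W. d (\<phi> v) w \<le> q} x x'"
    using x x' be step by (intro pull_back_near[OF rm, of x x' b]) auto
  with x(3) have "joined E {v \<in> V. \<exists>w\<in>W. d (\<phi> v) w \<le> q} a x'" by (rule joined_trans)
  then show ?case using x' by blast
qed

lemma pull_back_joined:
  assumes rm: "rough_map c \<phi>" and ab: "a \<in> V" "b \<in> V" and W: "W \<subseteq> V"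
    and j: "joined E W (\<phi> a) (\<phi> b)"
  shows "joined E {v \<in> V. \<exists>w\<in>W. d (\<phi> v) w \<le> q} a b"
proof -
  obtain x where x: "x \<in> V" "d (\<phi> x) (\<phi> b) \<le> c"
      "joined E {v \<in> V. \<exists>w\<in>W. d (\<phi> v) w \<le> q} a x"
    using pull_back[OF rm ab(1) W j] by blast
  have "joined E {v \<in> V. \<exists>w\<in>W. d (\<phi> v) w \<le> q} x b"
    using x ab joined_in(2)[OF j] W by (intro pull_back_near[OF rm, of x b "\<phi> b"]) auto
  with x(3) show ?thesis by (rule joined_trans)
qed

text \<open>The \<open>r\<close>-ball at \<open>z\<close> has its image in the ball of radius
  \<open>c * r\<close>; the error \<open>q\<close> is at most \<open>q * r\<close> because
  \<open>r \<ge> 1\<close>, and the two add up to \<open>m * r\<close>.\<close>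

lemma pull_back_outside:
  assumes rm: "rough_map c \<phi>" and z: "z \<in> V" and v: "v \<in> V" and w: "w \<in> V"
    and r: "r \<ge> 1" and vw: "d (\<phi> v) w \<le> q" and far: "m * r < d (\<phi> z) w"
  shows "r < d z v"
proof -
  have "d (\<phi> z) w \<le> d (\<phi> z) (\<phi> v) + d (\<phi> v) w"
    using z v w rough_mapD[OF rm] by (intro dist_triangle) auto
  moreover have "q * 1 \<le> q * r" using r by (rule mult_le_mono2)
  moreover have "m * r = c * r + q * r" by (simp add: m_def algebra_simps)
  moreover have "d (\<phi> z) (\<phi> v) \<le> c * d z v" using z v rough_mapD[OF rm] by auto
  ultimately have "c * r < c * d z v" using vw far by linarith
  then show ?thesis by simp
qed

text \<open>A rough isometry carrying the centre \<open>y\<close> to a deepest vertex \<open>p\<close> of a finite pocket would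
  produce a pocket at \<open>p\<close> reaching even deeper.\<close>

theorem no_deep_pocket:
  assumes y: "y \<in> V" and r: "r \<ge> 1" and u: "u \<in> V" "\<kappa> * r < d y u"
  shows "infinite {w. joined E (outside y r) u w}"
proof
  assume fin: "finite {w. joined E (outside y r) u w}"
  define P where "P = {w. joined E (outside y r) u w}"
  have "1 * r \<le> \<kappa> * r" by (rule mult_le_mono1) (simp add: \<kappa>_def)
  then have "r < d y u" using u(2) by linarith
  then have "u \<in> outside y r" using u(1) by simp
  then have "u \<in> P" unfolding P_def by (simp add: joined_refl)
  then have "Max (d y ` P) \<in> d y ` P" using fin unfolding P_def by (intro Max_in) auto
  then obtain p where p: "p \<in> P" and p': "d y p = Max (d y ` P)" by auto
  have pmax: "d y w \<le> d y p" if "w \<in> P" for w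
    using fin that unfolding p' P_def by auto
  have PV: "P \<subseteq> V" using joined_in(2) unfolding P_def by fastforce
  have P_closed: "w \<in> P" if "joined E (outside y r) w p" for w
    using p that joined_common unfolding P_def by fast
  have P_closed': "w \<in> P" if "joined E (outside y r) p w" for w
    using that by (rule P_closed[OF joined_sym])
  have pV: "p \<in> V" using p PV by blast
  obtain \<phi> where rm: "rough_map c \<phi>" and \<phi>y: "\<phi> y = p" using rough[OF y pV] by blast
  define a where "a = \<phi> p"
  define \<rho> where "\<rho> = m * r"
  have aV: "a \<in> V" using rough_mapD(1)[OF rm pV] by (simp add: a_def)
  have "\<kappa> * r < d y p" using u(2) pmax[OF \<open>u \<in> P\<close>] by linarith
  \<comment> \<open>\<open>\<kappa>\<close> is chosen for this identity: the term with factor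
    \<open>c\<close> yields \<open>d p a > 2 * \<rho>\<close>, and \<open>\<rho> + r\<close> makes
    the \<open>r\<close>-ball at \<open>y\<close> disjoint from the \<open>\<rho>\<close>-ball at
    \<open>p\<close>.\<close>
  moreover have "\<kappa> * r = c * (2 * \<rho> + r) + \<rho> + r"
    by (simp add: \<kappa>_def \<rho>_def algebra_simps)
  ultimately have big: "c * (2 * \<rho> + r) + \<rho> + r < d y p" by simp
  have "d y p < c * (d p a + 1)"
    using rough_mapD(2)[OF rm y pV] by (simp add: \<phi>y a_def)
  with big have "c * (2 * \<rho> + r) < c * (d p a + 1)" by linarith
  then have "2 * \<rho> + r < d p a + 1" by (simp only: mult_less_cancel1)
  with r have pa: "2 * \<rho> < d p a" by linarith
  \<comment> \<open>\<open>Q\<close> is the image pocket. It is finite because its paths pull back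
    to paths from \<open>p\<close> that stay in \<open>P\<close>.\<close>
  define Q where "Q = {w. joined E (outside p \<rho>) a w}"
  have "Q \<subseteq> (\<Union>x\<in>P. gball (\<phi> x) c)"
  proof
    fix w assume "w \<in> Q"
    then have j: "joined E (outside p \<rho>) (\<phi> p) w" by (simp add: Q_def a_def)
    then obtain x where x: "x \<in> V" "d (\<phi> x) w \<le> c"
      "joined E {v \<in> V. \<exists>w\<in>outside p \<rho>. d (\<phi> v) w \<le> q} p x"
      using pull_back[OF rm pV _ j] by blast
    have "{v \<in> V. \<exists>w\<in>outside p \<rho>. d (\<phi> v) w \<le> q} \<subseteq> outside y r"
      using pull_back_outside[OF rm y _ _ r] by (auto simp: \<phi>y \<rho>_def)
    then have "x \<in> P" using x(3) by (intro P_closed') (rule joined_mono)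
    moreover have "w \<in> V" using joined_in(2)[OF j] by simp
    ultimately show "w \<in> (\<Union>x\<in>P. gball (\<phi> x) c)" using x(2) by blast
  qed
  moreover have "finite (\<Union>x\<in>P. gball (\<phi> x) c)"
    using fin PV rough_mapD(1)[OF rm] finite_gball unfolding P_def by blast
  ultimately have finQ: "finite Q" by (rule finite_subset)
  have disj: "\<rho> < d p t" if "t \<in> V" "d y t \<le> r" for t
  proof -
    have "d y p \<le> d y t + d t p" using y pV that by (intro dist_triangle)
    then show ?thesis using that(2) big by (simp add: dist_sym)
  qed
  have toward: "joined E (outside y r) v p"
    if "v \<in> V" "\<not> joined E (outside p \<rho>) v y" for v
  proof -
    have "joined E {t \<in> V. r < d y t \<and> d p t \<le> d p v} v p"
      using that y pV disj
      by (intro joined_toward[where W = "outside p \<rho>" and \<rho> = \<rho>]) auto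
    then show ?thesis by (rule joined_mono) auto
  qed
  show False
  proof (cases "y \<in> Q")
    case True
    \<comment> \<open>A vertex outside both finite sets is cut off from \<open>y\<close> by the ball
      at \<open>p\<close>, hence reaches \<open>p\<close> around the ball at \<open>y\<close>, which
      puts it in \<open>P\<close> after all.\<close>
    have "finite (Q \<union> P)"
      using finQ fin by (simp add: P_def)
    then obtain w where w: "w \<in> V" "w \<notin> Q" "w \<notin> P"
      using infV finite_subset[of V "Q \<union> P"] by blast
    have "\<not> joined E (outside p \<rho>) w y"
    proof
      assume "joined E (outside p \<rho>) w y"
      then have "joined E (outside p \<rho>) a w"
        using True joined_common unfolding Q_def by fast
      then show False using w(2) by (simp add: Q_def)
    qed
    then show False using toward w P_closed by blast
  next
    case False
    then have nj: "\<not> joined E (outside p \<rho>) a y" by (simp add: Q_def)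
    then have aP: "a \<in> P" using toward aV P_closed by blast
    \<comment> \<open>A geodesic from \<open>y\<close> to \<open>a\<close> must cross the
      \<open>\<rho>\<close>-ball at \<open>p\<close>. Since \<open>d p a > 2 * \<rho>\<close>, this
      makes \<open>a\<close>, a member of \<open>P\<close>, deeper than \<open>p\<close>.\<close>
    have "\<not> {t \<in> V. d y t + d t a = d y a} \<subseteq> outside p \<rho>"
    proof
      assume "{t \<in> V. d y t + d t a = d y a} \<subseteq> outside p \<rho>"
      then have "joined E (outside p \<rho>) y a" by (rule joined_mono[OF joined_interval[OF y aV]])
      then show False using nj joined_sym[of E "outside p \<rho>" y a] by blast
    qed
    then obtain t where t: "t \<in> V" "d y t + d t a = d y a" "d p t \<le> \<rho>" by force
    have "d y p \<le> d y t + d t p" "d p a \<le> d p t + d t a"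
      using t pV aV y by (auto intro: dist_triangle)
    then have "d y p < d y a" using t pa by (simp add: dist_sym)
    then show False using pmax[OF aP] by simp
  qed
qed

section \<open>Arms leaving a ball: separation, transfer and branching\<close>

lemma slide:
  assumes "y \<in> V" "r \<ge> 1" "u \<in> V" "\<kappa> * r < d y u" "z \<in> V" "d z u \<le> h"
  obtains w where "d z w = h" "joined E {t \<in> V. r < d y t \<and> d z t \<le> h} u w"
proof -
  have "{w. joined E (outside y r) u w} \<subseteq> V" using joined_in(2) by fastforce
  then obtain b where b: "joined E (outside y r) u b" "h < d z b"
    using far_vertex[OF \<open>z \<in> V\<close> no_deep_pocket[OF assms(1-4)], of h] by blast
  obtain w where w: "d z w = h" "joined E {t \<in> outside y r. d z t \<le> h} u w"
    using joined_ivt[OF b(1) _ assms(5,6)] b(2) by auto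
  have "joined E {t \<in> V. r < d y t \<and> d z t \<le> h} u w"
    by (rule joined_mono[OF w(2)]) auto
  with w(1) show thesis by (rule that)
qed

text \<open>By \<open>no_deep_pocket\<close> each of the \<open>k\<close> endpoints of a star lies on an arm to infinity when \<open>\<kappa> * \<rho> < h\<close>,
  although only endpoints are recorded.\<close>

definition star :: "nat \<Rightarrow> 'a \<Rightarrow> nat \<Rightarrow> nat \<Rightarrow> nat \<Rightarrow> bool" where
  "star k z \<rho> h S \<longleftrightarrow> (\<exists>A. card A = k \<and> (\<forall>a\<in>A. a \<in> V \<and> d z a = h) \<and>
     (\<forall>a\<in>A. \<forall>b\<in>A. a \<noteq> b \<longrightarrow> \<not> joined E (ann z \<rho> S) a b))"

lemma starE:
  assumes "star k z \<rho> h S"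
  obtains A where "card A = k" "\<forall>a\<in>A. a \<in> V \<and> d z a = h"
    "\<forall>a\<in>A. \<forall>b\<in>A. a \<noteq> b \<longrightarrow> \<not> joined E (ann z \<rho> S) a b"
proof -
  obtain A where "card A = k \<and> (\<forall>a\<in>A. a \<in> V \<and> d z a = h) \<and>
     (\<forall>a\<in>A. \<forall>b\<in>A. a \<noteq> b \<longrightarrow> \<not> joined E (ann z \<rho> S) a b)"
    using assms unfolding star_def by (rule exE)
  then show thesis by (intro that[of A]) simp_all
qed

text \<open>Vertices deeper than \<open>\<kappa> * \<rho>\<close> lie on arms to infinity, so each
  can be moved within its component of the annulus to depth exactly \<open>h\<close>. Separation
  persists, and the new endpoints are distinct since equal ones would be joined.\<close>

lemma starI_slide:
  assumes z: "z \<in> V" and \<rho>: "\<rho> \<ge> 1" and h: "h \<le> S"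
    and A: "\<And>a. a \<in> A \<Longrightarrow> a \<in> V \<and> \<kappa> * \<rho> < d z a \<and> d z a \<le> h"
    and nj: "\<And>a b. a \<in> A \<Longrightarrow> b \<in> A \<Longrightarrow> a \<noteq> b \<Longrightarrow> \<not> joined E (ann z \<rho> S) a b"
  shows "star (card A) z \<rho> h S"
proof -
  have "\<exists>w. d z w = h \<and> joined E (ann z \<rho> S) a w" if a: "a \<in> A" for a
  proof -
    obtain w where w: "d z w = h" "joined E {t \<in> V. \<rho> < d z t \<and> d z t \<le> h} a w"
      using slide[OF z \<rho>, of a z h] A[OF a] z by blast
    have "joined E (ann z \<rho> S) a w" by (rule joined_mono[OF w(2)]) (use h in auto)
    with w(1) show ?thesis by blast
  qed
  then have "\<forall>a\<in>A. \<exists>w. d z w = h \<and> joined E (ann z \<rho> S) a w" by (rule ballI)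
  then obtain f where f': "\<forall>a\<in>A. d z (f a) = h \<and> joined E (ann z \<rho> S) a (f a)"
    by (rule exE[OF bchoice])
  note f = f'[THEN bspec, THEN conjunct1] f'[THEN bspec, THEN conjunct2]
  have *: "\<not> joined E (ann z \<rho> S) (f a) (f b)" if "a \<in> A" "b \<in> A" "a \<noteq> b" for a b
  proof
    assume "joined E (ann z \<rho> S) (f a) (f b)"
    with f(2)[OF that(1)] have "joined E (ann z \<rho> S) a (f b)" by (rule joined_trans)
    from this f(2)[OF that(2)] have "joined E (ann z \<rho> S) a b" by (rule joined_common)
    then show False using nj[OF that] by simp
  qed
  have inj: "inj_on f A"
  proof (rule inj_onI, rule ccontr)
    fix a b assume ab: "a \<in> A" "b \<in> A" "f a = f b" "a \<noteq> b"
    then show False using *[of a b] joined_in(2)[OF f(2)[of a]] by (auto intro: joined_refl)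
  qed
  show ?thesis unfolding star_def
  proof (intro exI conjI ballI impI)
    show "card (f ` A) = card A" using inj by (rule card_image)
    fix w assume "w \<in> f ` A"
    then obtain a where a: "a \<in> A" "w = f a" by blast
    show "w \<in> V" using joined_in(2)[OF f(2)[OF a(1)]] a by simp
    show "d z w = h" using f a by simp
    fix w' assume "w' \<in> f ` A" "w \<noteq> w'"
    then show "\<not> joined E (ann z \<rho> S) w w'" using * a by blast
  qed
qed

text \<open>A path between image endpoints pulls back into the annulus of \<open>z\<close>; this
  costs the factor \<open>m\<close> inside and about a factor \<open>c\<close> outside. The lower
  bound on \<open>h\<close> keeps the images deeper than \<open>\<kappa> * (m * \<rho>)\<close>, so
  that they can be slid to the common depth \<open>c * h\<close>.\<close>

lemma star_transfer:
  assumes st: "star k z \<rho> h S" and z: "z \<in> V" "z' \<in> V" and \<rho>: "\<rho> \<ge> 1"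
    and h: "c * (\<kappa> * (m * \<rho>) + 1) \<le> h" and S': "c * (S' + q + 1) \<le> S" and ch: "c * h \<le> S'"
  shows "star k z' (m * \<rho>) (c * h) S'"
proof -
  obtain A where A': "card A = k" "\<forall>a\<in>A. a \<in> V \<and> d z a = h"
    "\<forall>a\<in>A. \<forall>b\<in>A. a \<noteq> b \<longrightarrow> \<not> joined E (ann z \<rho> S) a b"
    by (rule starE[OF st])
  have A: "card A = k" "\<And>a. a \<in> A \<Longrightarrow> a \<in> V" "\<And>a. a \<in> A \<Longrightarrow> d z a = h"
    "\<And>a b. a \<in> A \<Longrightarrow> b \<in> A \<Longrightarrow> a \<noteq> b \<Longrightarrow> \<not> joined E (ann z \<rho> S) a b"
    using A' by auto
  obtain \<phi> where rm: "rough_map c \<phi>" and \<phi>z: "\<phi> z = z'" using rough[OF z] by blast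
  note rmD = rough_mapD[OF rm]
  have nj: "\<not> joined E (ann z' (m * \<rho>) S') (\<phi> a) (\<phi> b)" if ab: "a \<in> A" "b \<in> A" "a \<noteq> b" for a b
  proof
    assume "joined E (ann z' (m * \<rho>) S') (\<phi> a) (\<phi> b)"
    then have "joined E {v \<in> V. \<exists>w\<in>ann z' (m * \<rho>) S'. d (\<phi> v) w \<le> q} a b"
      using ab A(2) by (intro pull_back_joined[OF rm]) auto
    moreover have "{v \<in> V. \<exists>w\<in>ann z' (m * \<rho>) S'. d (\<phi> v) w \<le> q} \<subseteq> ann z \<rho> S"
    proof
      fix v assume "v \<in> {v \<in> V. \<exists>w\<in>ann z' (m * \<rho>) S'. d (\<phi> v) w \<le> q}"
      then obtain w where v: "v \<in> V" and w: "w \<in> V" "m * \<rho> < d z' w" "d z' w \<le> S'" "d (\<phi> v) w \<le> q"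
        by blast
      have "\<rho> < d z v"
        using pull_back_outside[OF rm z(1) v w(1) \<rho> w(4)] w(2) by (simp add: \<phi>z)
      moreover have "d z v < c * (d z' (\<phi> v) + 1)" using rmD(2)[OF z(1) v] by (simp add: \<phi>z)
      moreover have "d z' (\<phi> v) \<le> d z' w + d w (\<phi> v)"
        using z v w rmD by (intro dist_triangle) auto
      then have "d z' (\<phi> v) + 1 \<le> S' + q + 1" using w by (simp add: dist_sym)
      then have "c * (d z' (\<phi> v) + 1) \<le> c * (S' + q + 1)" by (rule mult_le_mono2)
      ultimately have "\<rho> < d z v \<and> d z v \<le> S" using S' by linarith
      then show "v \<in> ann z \<rho> S" using v by simp
    qed
    ultimately have "joined E (ann z \<rho> S) a b" by (rule joined_mono)
    then show False using A(4) ab by blast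
  qed
  have dd: "\<kappa> * (m * \<rho>) < d z' (\<phi> a) \<and> d z' (\<phi> a) \<le> c * h" if a: "a \<in> A" for a
  proof -
    have "h < c * (d z' (\<phi> a) + 1)" using rmD(2)[OF z(1) A(2)[OF a]] A(3)[OF a] by (simp add: \<phi>z)
    then have "c * (\<kappa> * (m * \<rho>) + 1) < c * (d z' (\<phi> a) + 1)" using h by linarith
    then have "\<kappa> * (m * \<rho>) + 1 < d z' (\<phi> a) + 1" by (simp only: mult_less_cancel1)
    then show ?thesis using rmD(3)[OF z(1) A(2)[OF a]] A(3)[OF a] by (simp add: \<phi>z)
  qed
  have m1: "m * \<rho> \<ge> 1" using \<rho> c_pos by (simp add: m_def)
  have inj: "inj_on \<phi> A"
  proof (rule inj_onI, rule ccontr)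
    fix a b assume ab: "a \<in> A" "b \<in> A" "\<phi> a = \<phi> b" "a \<noteq> b"
    have "1 * (m * \<rho>) \<le> \<kappa> * (m * \<rho>)" by (rule mult_le_mono1) (simp add: \<kappa>_def)
    then have "m * \<rho> < d z' (\<phi> a) \<and> d z' (\<phi> a) \<le> S'" using dd[OF ab(1)] ch by linarith
    then have "\<phi> a \<in> ann z' (m * \<rho>) S'" using rmD(1) A(2) ab(1) by simp
    then show False using nj[of a b] ab by (auto intro: joined_refl)
  qed
  have "star (card (\<phi> ` A)) z' (m * \<rho>) (c * h) S'"
  proof (rule starI_slide[OF z(2) m1 ch])
    fix w assume "w \<in> \<phi> ` A"
    then show "w \<in> V \<and> \<kappa> * (m * \<rho>) < d z' w \<and> d z' w \<le> c * h" using dd rmD(1) A(2) by blast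
  next
    fix v w assume "v \<in> \<phi> ` A" "w \<in> \<phi> ` A" "v \<noteq> w"
    then show "\<not> joined E (ann z' (m * \<rho>) S') v w" using nj by blast
  qed
  then show ?thesis using A(1) card_image[OF inj] by simp
qed

lemma star2_avoid:
  assumes "star 2 z \<rho> h S"
  obtains a where "a \<in> V" "d z a = h" "\<not> joined E (ann z \<rho> S) a w"
proof -
  obtain A where A': "card A = 2" "\<forall>a\<in>A. a \<in> V \<and> d z a = h"
    "\<forall>a\<in>A. \<forall>b\<in>A. a \<noteq> b \<longrightarrow> \<not> joined E (ann z \<rho> S) a b"
    by (rule starE[OF assms])
  note A = A'(1) A'(2)[rule_format] A'(3)[rule_format]
  obtain a b where ab: "a \<in> A" "b \<in> A" "a \<noteq> b" using A(1) by (auto simp: card_2_iff)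
  then have "\<not> joined E (ann z \<rho> S) a w \<or> \<not> joined E (ann z \<rho> S) b w"
    using A(3)[OF ab] by (blast intro: joined_common)
  then show thesis using that A(2) ab by blast
qed

text \<open>A vertex \<open>w\<close> belongs to the component of at most one endpoint, so two
  remain. In the branching argument \<open>w\<close> is the direction from which the search
  arrives.\<close>

lemma star3_avoid:
  assumes "star 3 z \<rho> h S"
  obtains a b where "a \<in> V" "b \<in> V" "d z a = h" "d z b = h" "\<not> joined E (ann z \<rho> S) a b"
    "\<not> joined E (ann z \<rho> S) a w" "\<not> joined E (ann z \<rho> S) b w"
proof -
  obtain A where A': "card A = 3" "\<forall>a\<in>A. a \<in> V \<and> d z a = h"
    "\<forall>a\<in>A. \<forall>b\<in>A. a \<noteq> b \<longrightarrow> \<not> joined E (ann z \<rho> S) a b"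
    by (rule starE[OF assms])
  note A = A'(1) A'(2)[rule_format] A'(3)[rule_format]
  obtain x y t where xyt: "x \<in> A" "y \<in> A" "t \<in> A" "x \<noteq> y" "y \<noteq> t" "x \<noteq> t"
    using A(1) by (auto simp: card_3_iff)
  have one: "\<not> joined E (ann z \<rho> S) u w \<or> \<not> joined E (ann z \<rho> S) v w" if "u \<in> A" "v \<in> A" "u \<noteq> v" for u v
    using A(3)[OF that] by (blast intro: joined_common)
  note result = that
  have pick: thesis
    if "u \<in> A" "v \<in> A" "u \<noteq> v" "\<not> joined E (ann z \<rho> S) u w" "\<not> joined E (ann z \<rho> S) v w" for u v
    using result[of u v] A(2)[of u] A(2)[of v] A(3)[of u v] that
    by simp
  show thesis
    using pick[of x y] pick[of y t] pick[of x t] one[of x y] one[of y t] one[of x t] xyt by argo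
qed

lemma joined_toward_ann:
  assumes V: "v \<in> V" "x \<in> V" "y \<in> V"
    and xy: "2 * \<rho> < d x y" "d x y + \<rho> \<le> S"
    and nj: "\<not> joined E (ann x \<rho> S) v y" and v: "d x v \<le> S"
  shows "joined E {t \<in> V. \<rho> < d y t \<and> d x t \<le> d x v} v x"
proof (rule joined_toward[OF V _ nj])
  have near: "d x y \<le> d x t + d y t" "d x t \<le> d x y + d y t" if "t \<in> V" for t
    using dist_triangle[OF V(2) that V(3)] dist_triangle[OF V(2,3) that] by (auto simp: dist_sym)
  show "\<rho> < d x t" if "t \<in> V" "d y t \<le> \<rho>" for t
    using near[OF that(1)] that(2) xy(1) by linarith
  show "{t \<in> V. \<rho> < d x t \<and> (d x t \<le> d x v \<or> d y t \<le> \<rho>)} \<subseteq> ann x \<rho> S"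
    using near xy(2) v by fastforce
qed

text \<open>Of the three arms at \<open>z\<close>, two avoid \<open>w\<close>, and at their
  endpoints there are stars again. The vertices that those stars cut off from \<open>z\<close> form
  two disjoint subtrees. The vertex \<open>w\<close> is arbitrary because the induction takes the
  parent \<open>z\<close> for it.\<close>

lemma branching_growth:
  assumes st: "\<And>z. z \<in> V \<Longrightarrow> star 3 z \<rho> h S" and h: "2 * \<rho> < h" "h + \<rho> \<le> S"
    and z: "z \<in> V" and n: "Suc n * h \<le> S"
  shows "2 ^ n \<le> card {v \<in> V. d z v \<le> Suc n * h \<and> \<not> joined E (ann z \<rho> S) v w}"
  using z n
proof (induction n arbitrary: z w)
  case 0
  obtain a where "a \<in> V" "d z a = h" "\<not> joined E (ann z \<rho> S) a w"
    by (rule star3_avoid[OF st[OF 0(1)], where w = w])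
  then have "a \<in> {v \<in> V. d z v \<le> Suc 0 * h \<and> \<not> joined E (ann z \<rho> S) v w}" by simp
  moreover have "finite {v \<in> V. d z v \<le> Suc 0 * h \<and> \<not> joined E (ann z \<rho> S) v w}"
    by (rule finite_subset[OF _ finite_gball[OF 0(1), of h]]) auto
  ultimately have "card {v \<in> V. d z v \<le> Suc 0 * h \<and> \<not> joined E (ann z \<rho> S) v w} > 0"
    by (auto simp: card_gt_0_iff)
  then show ?case by simp
next
  case (Suc n)
  obtain a b where ab: "a \<in> V" "b \<in> V" "d z a = h" "d z b = h" "\<not> joined E (ann z \<rho> S) a b"
    "\<not> joined E (ann z \<rho> S) a w" "\<not> joined E (ann z \<rho> S) b w"
    by (rule star3_avoid[OF st[OF Suc.prems(1)], where w = w])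
  define D where "D x = {v \<in> V. d x v \<le> Suc n * h \<and> \<not> joined E (ann x \<rho> S) v z}" for x
  let ?T = "{v \<in> V. d z v \<le> Suc (Suc n) * h \<and> \<not> joined E (ann z \<rho> S) v w}"
  have n': "Suc n * h \<le> S" using Suc.prems(2) by simp
  \<comment> \<open>What the ball at \<open>x\<close> cuts off from \<open>z\<close> reaches
    \<open>x\<close> around the ball at \<open>z\<close>. So \<open>D x\<close> lies in the
    component of \<open>x\<close> seen from \<open>z\<close>, which gives both disjointness of
    \<open>D a\<close> and \<open>D b\<close> and separation from \<open>w\<close>.\<close>
  have D_joined: "joined E (ann z \<rho> S) v x \<and> d z v \<le> Suc (Suc n) * h"
    if x: "x \<in> V" "d z x = h" and v: "v \<in> D x" for x v
  proof -
    have v': "v \<in> V" "d x v \<le> Suc n * h" "\<not> joined E (ann x \<rho> S) v z" using v by (auto simp: D_def)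
    have tri: "d z t \<le> h + d x t" if "t \<in> V" for t
      using dist_triangle[OF Suc.prems(1) x(1) that] x(2) by simp
    have "joined E {t \<in> V. \<rho> < d z t \<and> d x t \<le> d x v} v x"
      using x v' n' h Suc.prems(1) by (intro joined_toward_ann[where S = S]) (auto simp: dist_sym)
    then have "joined E (ann z \<rho> S) v x"
    proof (rule joined_mono)
      show "{t \<in> V. \<rho> < d z t \<and> d x t \<le> d x v} \<subseteq> ann z \<rho> S"
        using tri v'(2) Suc.prems(2) by fastforce
    qed
    then show ?thesis using tri[OF v'(1)] v'(2) by simp
  qed
  have "D a \<union> D b \<subseteq> ?T"
  proof
    fix v assume v: "v \<in> D a \<union> D b"
    then obtain x where x: "x \<in> V" "d z x = h" "\<not> joined E (ann z \<rho> S) x w" "v \<in> D x"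
    proof (elim UnE)
      note prem = that
      show thesis if "v \<in> D a" using prem[OF ab(1,3,6) that] .
      show thesis if "v \<in> D b" using prem[OF ab(2,4,7) that] .
    qed
    have "joined E (ann z \<rho> S) x v" using D_joined[OF x(1,2,4)] by (blast intro: joined_sym)
    then have "\<not> joined E (ann z \<rho> S) v w" using x(3) joined_trans[of E "ann z \<rho> S" x v w] by blast
    then show "v \<in> ?T" using D_joined[OF x(1,2,4)] v by (auto simp: D_def)
  qed
  moreover have "finite ?T"
    by (rule finite_subset[OF _ finite_gball[OF Suc.prems(1), of "Suc (Suc n) * h"]]) auto
  ultimately have "card (D a \<union> D b) \<le> card ?T" by (intro card_mono)
  moreover have "D a \<inter> D b = {}"
  proof (rule equals0I)
    fix v assume "v \<in> D a \<inter> D b"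
    then have "joined E (ann z \<rho> S) a v" "joined E (ann z \<rho> S) v b"
      using D_joined[OF ab(1,3)] D_joined[OF ab(2,4)] by (blast intro: joined_sym)+
    then show False using ab(5) joined_trans[of E "ann z \<rho> S" a v b] by blast
  qed
  moreover have "finite (D x)" if "x \<in> V" for x
    by (rule finite_subset[OF _ finite_gball[OF that, of "Suc n * h"]]) (auto simp: D_def)
  ultimately have "card (D a) + card (D b) \<le> card ?T"
    using ab by (simp add: card_Un_disjoint)
  moreover have "2 ^ n \<le> card (D a)" "2 ^ n \<le> card (D b)"
    unfolding D_def using Suc.IH ab n' by blast+
  ultimately show ?case by simp
qed

section \<open>Annuli are connected\<close>

text \<open>A far vertex \<open>b\<close> would give a third arm at \<open>y\<close>, besides those continuing through \<open>x\<close> and \<open>z\<close>.\<close>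

lemma between_bounded:
  assumes st2: "\<And>z. z \<in> V \<Longrightarrow> star 2 z \<rho> h S"
    and no3: "\<not> star 3 y (h + \<rho>) t (S - h)"
    and \<rho>: "\<rho> \<ge> 1" "\<kappa> * \<rho> < h" "3 * \<rho> < h" and t: "2 * h \<le> t" "t + 3 * h + \<rho> \<le> S"
    and V: "x \<in> V" "y \<in> V" "z \<in> V" and xyz: "d y x = h" "d y z = h"
    and nj: "\<not> joined E (ann y \<rho> S) x z"
    and b: "joined E {v \<in> V. \<rho> < d x v \<and> \<rho> < d z v} y b"
  shows "d y b \<le> t"
proof (rule ccontr)
  assume "\<not> d y b \<le> t"
  then have tb: "t \<le> d y b" by simp
  have nj': "\<not> joined E (ann y \<rho> S) z x" using nj joined_sym[of E "ann y \<rho> S" z x] by blast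
  have triy: "d y v \<le> h + d x v" "d y v \<le> h + d z v" "d x v \<le> h + d y v" "d z v \<le> h + d y v"
    "h \<le> d y v + d x v" "h \<le> d y v + d z v" if v: "v \<in> V" for v
    using dist_triangle[OF V(2,1) v] dist_triangle[OF V(2,3) v] dist_triangle[OF V(1,2) v]
      dist_triangle[OF V(3,2) v] dist_triangle[OF V(2) v V(1)] dist_triangle[OF V(2) v V(3)] xyz
    by (auto simp: dist_sym)
  have far: "2 * \<rho> < d x z"
  proof (rule ccontr)
    assume *: "\<not> 2 * \<rho> < d x z"
    have "joined E (ann y \<rho> S) x z"
    proof (rule joined_mono[OF joined_interval[OF V(1,3)]])
      show "{t \<in> V. d x t + d t z = d x z} \<subseteq> ann y \<rho> S"
      proof
        fix v assume v: "v \<in> {t \<in> V. d x t + d t z = d x z}"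
        then have "d x v \<le> 2 * \<rho>" "v \<in> V" using * by auto
        then show "v \<in> ann y \<rho> S" using triy(1,5)[of v] \<rho>(3) t by auto
      qed
    qed
    then show False using nj by simp
  qed
  have zy: "joined E {v \<in> V. \<rho> < d x v \<and> d y v \<le> d y z} z y"
    using V xyz nj' \<rho> t by (intro joined_toward_ann[where S = S]) auto
  have xy: "joined E {v \<in> V. \<rho> < d z v \<and> d y v \<le> d y x} x y"
    using V xyz nj \<rho> t by (intro joined_toward_ann[where S = S]) auto
  \<comment> \<open>The three endpoints at distance \<open>t\<close> from \<open>y\<close> will be
    \<open>f\<close>, reached from \<open>y\<close> while avoiding the balls at \<open>x\<close> and
    \<open>z\<close>; \<open>p\<close>, beyond \<open>z\<close>; and \<open>s\<close>, beyond
    \<open>x\<close>.\<close>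
  obtain f where f: "d y f = t" "joined E {v \<in> {v \<in> V. \<rho> < d x v \<and> \<rho> < d z v}. d y v \<le> t} y f"
    using joined_ivt[OF b _ V(2) _ tb] by auto
  have arm: "\<exists>p. d y p = t \<and> joined E (ann w \<rho> S) a p"
    if w: "w \<in> V" "d y w = h" and a: "a \<in> V" "d w a = h" for w a
  proof -
    have tri: "d y v \<le> h + d w v" "d w v \<le> h + d y v" if v: "v \<in> V" for v
      using dist_triangle[OF V(2) w(1) v] dist_triangle[OF w(1) V(2) v] w(2) by (auto simp: dist_sym)
    have "d y a \<le> t" using tri(1)[OF a(1)] a(2) t(1) by simp
    then obtain p where p: "d y p = t" "joined E {v \<in> V. \<rho> < d w v \<and> d y v \<le> t} a p"
      using slide[OF w(1) \<rho>(1) a(1) _ V(2)] a(2) \<rho>(2) by blast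
    have "joined E (ann w \<rho> S) a p"
      by (rule joined_mono[OF p(2)]) (use tri(2) t(2) in fastforce)
    then show ?thesis using p(1) by blast
  qed
  obtain a where a: "a \<in> V" "d z a = h" "\<not> joined E (ann z \<rho> S) a y"
    by (rule star2_avoid[OF st2[OF V(3)], where w = y])
  obtain p where p: "d y p = t" "joined E (ann z \<rho> S) a p"
    using arm[OF V(3) xyz(2) a(1,2)] by blast
  obtain a' where a': "a' \<in> V" "d x a' = h" "\<not> joined E (ann x \<rho> S) a' y"
    by (rule star2_avoid[OF st2[OF V(1)], where w = y])
  obtain s where s: "d y s = t" "joined E (ann x \<rho> S) a' s"
    using arm[OF V(1) xyz(1) a'(1,2)] by blast
  have Vs: "f \<in> V" "p \<in> V" "s \<in> V"
    using joined_in(2)[OF f(2)] joined_in(2)[OF p(2)] joined_in(2)[OF s(2)] by auto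
  have p_y: "\<not> joined E (ann z \<rho> S) p y" using a(3) joined_trans[OF p(2)] by blast
  have s_y: "\<not> joined E (ann x \<rho> S) s y" using a'(3) joined_trans[OF s(2)] by blast
  have f_x: "joined E (ann x \<rho> S) y f"
    by (rule joined_mono[OF f(2)]) (use triy(3) t(2) in fastforce)
  have f_z: "joined E (ann z \<rho> S) y f"
    by (rule joined_mono[OF f(2)]) (use triy(4) t(2) in fastforce)
  \<comment> \<open>Seen from \<open>z\<close>, the vertex \<open>s\<close> is on the side of
    \<open>y\<close>: it reaches \<open>x\<close> around the ball at \<open>z\<close>, and so does
    \<open>x\<close> reach \<open>y\<close>.\<close>
  have "joined E (ann x \<rho> S) z y"
    by (rule joined_mono[OF zy]) (use triy(3) t xyz(2) in fastforce)
  then have "\<not> joined E (ann x \<rho> S) s z" using s_y joined_trans[of E "ann x \<rho> S" s z y] by blast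
  moreover have "d x s \<le> h + t" "d x z \<le> 2 * h" using triy(3) Vs(3) V(3) s(1) xyz(2) by fastforce+
  ultimately have "joined E {v \<in> V. \<rho> < d z v \<and> d x v \<le> d x s} s x"
    using Vs(3) V far t by (intro joined_toward_ann[where S = S]) auto
  then have "joined E (ann z \<rho> S) s x"
  proof (rule joined_mono)
    show "{v \<in> V. \<rho> < d z v \<and> d x v \<le> d x s} \<subseteq> ann z \<rho> S"
    proof
      fix v assume v: "v \<in> {v \<in> V. \<rho> < d z v \<and> d x v \<le> d x s}"
      then have "v \<in> V" by simp
      then have "d z v \<le> h + d y v" "d y v \<le> h + d x v" using triy by auto
      then show "v \<in> ann z \<rho> S" using v \<open>d x s \<le> h + t\<close> t by auto
    qed
  qed
  moreover have "joined E (ann z \<rho> S) x y"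
    by (rule joined_mono[OF xy]) (use triy(4) t xyz(1) in fastforce)
  ultimately have s_z: "joined E (ann z \<rho> S) s y" by (rule joined_trans)
  \<comment> \<open>The inner radius \<open>h + \<rho>\<close> covers the
    \<open>\<rho>\<close>-balls at \<open>x\<close> and \<open>z\<close>, and the outer radius keeps
    \<open>?N\<close> within distance \<open>S\<close> of both, so a path in \<open>?N\<close> is a
    path in both their annuli.\<close>
  let ?N = "ann y (h + \<rho>) (S - h)"
  have N: "?N \<subseteq> ann x \<rho> S" "?N \<subseteq> ann z \<rho> S"
    using triy t by fastforce+
  have fp: "\<not> joined E ?N f p"
  proof
    assume "joined E ?N f p"
    then have "joined E (ann z \<rho> S) f p" using N(2) by (rule joined_mono)
    with f_z have "joined E (ann z \<rho> S) y p" by (rule joined_trans)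
    then show False using p_y joined_sym[of E "ann z \<rho> S" y p] by blast
  qed
  have fs: "\<not> joined E ?N f s"
  proof
    assume "joined E ?N f s"
    then have "joined E (ann x \<rho> S) f s" using N(1) by (rule joined_mono)
    with f_x have "joined E (ann x \<rho> S) y s" by (rule joined_trans)
    then show False using s_y joined_sym[of E "ann x \<rho> S" y s] by blast
  qed
  have ps: "\<not> joined E ?N p s"
  proof
    assume "joined E ?N p s"
    then have "joined E (ann z \<rho> S) p s" using N(2) by (rule joined_mono)
    from this s_z have "joined E (ann z \<rho> S) p y" by (rule joined_trans)
    then show False using p_y by blast
  qed
  have "v \<in> ?N" if "v \<in> V" "d y v = t" for v using that \<rho> t by auto
  then have refl: "joined E ?N f f" "joined E ?N p p" "joined E ?N s s"
    using Vs f(1) p(1) s(1) by (auto intro!: joined_refl)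
  then have ne: "f \<noteq> p" "f \<noteq> s" "p \<noteq> s" using fp fs ps by blast+
  have sym: "\<not> joined E ?N b a" if "\<not> joined E ?N a b" for a b
    using that joined_sym[of E ?N b a] by blast
  have "star 3 y (h + \<rho>) t (S - h)" unfolding star_def
  proof (intro exI[of _ "{f, p, s}"] conjI)
    show "card {f, p, s} = 3" using ne by simp
    show "\<forall>a\<in>{f, p, s}. a \<in> V \<and> d y a = t" using Vs f(1) p(1) s(1) by simp
    show "\<forall>a\<in>{f, p, s}. \<forall>b\<in>{f, p, s}. a \<noteq> b \<longrightarrow> \<not> joined E ?N a b"
      using fp fs ps sym[OF fp] sym[OF fs] sym[OF ps] by blast
  qed
  then show False using no3 by simp
qed

text \<open>Each new vertex has to be cut off from the last but one, so the dependent choice runs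
  over pairs of consecutive vertices.\<close>

lemma chain_exists:
  assumes st2: "\<And>z. z \<in> V \<Longrightarrow> star 2 z \<rho> h S"
  obtains z :: "nat \<Rightarrow> 'a" where "\<And>i. z i \<in> V" "\<And>i. d (z i) (z (Suc i)) = h"
    "\<And>i. \<not> joined E (ann (z (Suc i)) \<rho> S) (z i) (z (Suc (Suc i)))"
proof -
  obtain x where x: "x \<in> V" using infV by fastforce
  obtain x' where x': "x' \<in> V" "d x x' = h" by (rule star2_avoid[OF st2[OF x]])
  have "\<exists>f. \<forall>n. (fst (f n) \<in> V \<and> snd (f n) \<in> V \<and> d (fst (f n)) (snd (f n)) = h) \<and>
     (fst (f (Suc n)) = snd (f n) \<and>
      \<not> joined E (ann (snd (f n)) \<rho> S) (fst (f n)) (snd (f (Suc n))))"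
  proof (rule dependent_nat_choice)
    show "\<exists>p. fst p \<in> V \<and> snd p \<in> V \<and> d (fst p) (snd p) = h"
      using x x' by (intro exI[of _ "(x, x')"]) simp
  next
    fix p :: "'a \<times> 'a" and n :: nat
    assume p: "fst p \<in> V \<and> snd p \<in> V \<and> d (fst p) (snd p) = h"
    obtain a where a: "a \<in> V" "d (snd p) a = h" "\<not> joined E (ann (snd p) \<rho> S) a (fst p)"
      using p by (auto intro: star2_avoid[OF st2[of "snd p"], where w = "fst p"])
    then have "\<not> joined E (ann (snd p) \<rho> S) (fst p) a"
      using joined_sym[of E "ann (snd p) \<rho> S" "fst p" a] by blast
    then show "\<exists>p'. (fst p' \<in> V \<and> snd p' \<in> V \<and> d (fst p') (snd p') = h) \<and>
       (fst p' = snd p \<and> \<not> joined E (ann (snd p) \<rho> S) (fst p) (snd p'))"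
      using p a by (intro exI[of _ "(snd p, a)"]) simp
  qed
  then obtain f where f: "\<forall>n. (fst (f n) \<in> V \<and> snd (f n) \<in> V \<and> d (fst (f n)) (snd (f n)) = h) \<and>
     (fst (f (Suc n)) = snd (f n) \<and>
      \<not> joined E (ann (snd (f n)) \<rho> S) (fst (f n)) (snd (f (Suc n))))"
    by (rule exE)
  have snd: "snd (f n) = fst (f (Suc n))" for n using f by simp
  show thesis
  proof (rule that[of "\<lambda>n. fst (f n)"])
    fix i
    show "fst (f i) \<in> V" using f by simp
    show "d (fst (f i)) (fst (f (Suc i))) = h" using f by (simp flip: snd)
    have "\<not> joined E (ann (snd (f i)) \<rho> S) (fst (f i)) (snd (f (Suc i)))" using f by simp
    then show "\<not> joined E (ann (fst (f (Suc i))) \<rho> S) (fst (f i)) (fst (f (Suc (Suc i))))"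
      unfolding snd .
  qed
qed

end

section \<open>A line of balls against the isoperimetric inequality\<close>

lemma finite_subset_UN_lessThan:
  assumes "finite T" "T \<subseteq> (\<Union>i::nat. F i)"
  shows "\<exists>N. T \<subseteq> (\<Union>i<N. F i)"
  using assms
proof (induction T rule: finite_induct)
  case (insert x T)
  then obtain N i where "T \<subseteq> (\<Union>i<N. F i)" "x \<in> F i" by blast
  then have "insert x T \<subseteq> (\<Union>i<max N (Suc i). F i)" by fastforce
  then show ?case ..
qed simp

text \<open>\<open>bounded_boundary\<close> is the form in which the isoperimetric inequality is
  used: sets with small boundary have bounded size.\<close>

locale growth_graph = rough_graph +
  fixes g D :: nat
  assumes growth: "x \<in> V \<Longrightarrow> r \<ge> 1 \<Longrightarrow> card (gball x r) \<le> g * r ^ D"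
    and bounded_boundary: "\<exists>M. \<forall>A. finite A \<longrightarrow> A \<subseteq> V \<longrightarrow> finite (edge_boundary E A) \<longrightarrow>
      card (edge_boundary E A) \<le> K \<longrightarrow> card A \<le> M"
begin

text \<open>Without branching, the segments between the balls around the first and last members of an
  infinite chain exhaust an infinite set, while only these two balls bound them.\<close>

lemma not_linear:
  assumes st2: "\<And>z. z \<in> V \<Longrightarrow> star 2 z \<rho> h S"
    and no3: "\<And>y. y \<in> V \<Longrightarrow> \<not> star 3 y (h + \<rho>) t (S - h)"
    and \<rho>: "\<rho> \<ge> 1" "\<kappa> * \<rho> < h" "3 * \<rho> < h" and t: "2 * h \<le> t" "t + 3 * h + \<rho> \<le> S"
  shows False
proof -
  obtain z :: "nat \<Rightarrow> 'a" where z: "\<And>i. z i \<in> V" "\<And>i. d (z i) (z (Suc i)) = h"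
    "\<And>i. \<not> joined E (ann (z (Suc i)) \<rho> S) (z i) (z (Suc (Suc i)))"
    using chain_exists[OF st2] by blast
  \<comment> \<open>Indices are shifted by one: \<open>F i\<close> is the segment around
    \<open>z (Suc i)\<close>, delimited by the balls at \<open>z i\<close> and
    \<open>z (Suc (Suc i))\<close>.\<close>
  define W where "W i = {v \<in> V. \<rho> < d (z i) v \<and> \<rho> < d (z (Suc (Suc i))) v}" for i
  define F where "F i = {v. joined E (W i) (z (Suc i)) v}" for i
  have F_ball: "F i \<subseteq> gball (z (Suc i)) t" for i
  proof
    fix v assume "v \<in> F i"
    then have j: "joined E (W i) (z (Suc i)) v" by (simp add: F_def)
    have "d (z (Suc i)) v \<le> t"
    proof (rule between_bounded[OF st2 no3 \<rho> t])
      show "d (z (Suc i)) (z i) = h" using z(2)[of i] by (simp add: dist_sym)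
      show "joined E {v \<in> V. \<rho> < d (z i) v \<and> \<rho> < d (z (Suc (Suc i))) v} (z (Suc i)) v"
        using j by (simp add: W_def)
    qed (use z in auto)
    then show "v \<in> gball (z (Suc i)) t" using joined_in(2)[OF j] by (simp add: W_def)
  qed
  have finF: "finite (F i)" for i
    using F_ball finite_gball[OF z(1)] by (rule finite_subset)
  have ball_F: "gball (z (Suc i)) \<rho> \<subseteq> F i" for i
  proof
    fix v assume v: "v \<in> gball (z (Suc i)) \<rho>"
    have "gball (z (Suc i)) \<rho> \<subseteq> W i"
    proof
      fix w assume w: "w \<in> gball (z (Suc i)) \<rho>"
      then have "h \<le> d (z i) w + d (z (Suc i)) w" "h \<le> d (z (Suc (Suc i))) w + d (z (Suc i)) w"
        using dist_triangle[OF z(1)[of i] _ z(1)[of "Suc i"], of w]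
          dist_triangle[OF z(1)[of "Suc (Suc i)"] _ z(1)[of "Suc i"], of w] z(2)[of i] z(2)[of "Suc i"]
        by (auto simp: dist_sym)
      then show "w \<in> W i" using w \<rho> by (auto simp: W_def)
    qed
    then have "joined E (W i) v (z (Suc i))"
      using joined_gball[OF z(1) v] by (rule joined_mono[rotated])
    then show "v \<in> F i" unfolding F_def by (auto intro: joined_sym)
  qed
  have exit: "w \<in> gball (z i) \<rho> \<or> w \<in> gball (z (Suc (Suc i))) \<rho>"
    if "v \<in> F i" "{v, w} \<in> E" "w \<notin> F i" for v w i
  proof -
    have "w \<notin> W i" using that joined_step[of E "W i" "z (Suc i)" v w] by (auto simp: F_def)
    then show ?thesis using edge_V[OF that(2)] by (auto simp: W_def)
  qed
  define A where "A N = (\<Union>i<N. F i)" for N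
  define B where "B = g * (\<rho> + 1) ^ D"
  \<comment> \<open>An edge leaving \<open>F i\<close> ends in the ball of a neighbouring chain
    vertex, and that ball lies in another segment unless it is the one at \<open>z 0\<close> or
    \<open>z (Suc N)\<close>. The radius \<open>\<rho> + 1\<close> also captures the inner end of
    the edge, so the bound is uniform in \<open>N\<close>.\<close>
  have bd: "finite (edge_boundary E (A N)) \<and> card (edge_boundary E (A N)) \<le> 2 * (B * B)" for N
  proof -
    let ?b = "\<lambda>x. gball x (\<rho> + 1) \<times> gball x (\<rho> + 1)"
    let ?P = "?b (z 0) \<union> ?b (z (Suc N))"
    have "edge_boundary E (A N) \<subseteq> (\<lambda>(v, w). {v, w}) ` ?P"
    proof
      fix e assume "e \<in> edge_boundary E (A N)"
      then obtain v w i where e: "e = {v, w}" "{v, w} \<in> E" "i < N" "v \<in> F i" "w \<notin> A N"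
        by (auto simp: edge_boundary_def A_def)
      have wF: "w \<notin> F j" if "j < N" for j using e(5) that by (auto simp: A_def)
      have "w \<in> gball (z 0) \<rho> \<or> w \<in> gball (z (Suc N)) \<rho>"
        using exit[OF e(4,2) wF[OF e(3)]]
      proof
        assume w: "w \<in> gball (z i) \<rho>"
        then have "i = 0" using ball_F[of "i - 1"] wF[of "i - 1"] e(3) by (cases i) auto
        then show ?thesis using w by simp
      next
        assume w: "w \<in> gball (z (Suc (Suc i))) \<rho>"
        then have "\<not> Suc i < N" using ball_F[of "Suc i"] wF[of "Suc i"] by blast
        then have "Suc i = N" using e(3) by simp
        then show ?thesis using w by simp
      qed
      then obtain x where x: "x = z 0 \<or> x = z (Suc N)" "w \<in> gball x \<rho>" by blast
      have "x \<in> V" using x(1) z(1) by auto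
      moreover have "{w, v} \<in> E" using e(2) by (simp add: insert_commute)
      ultimately have "d x v \<le> d x w + 1" by (rule dist_edge_le)
      then have "(v, w) \<in> ?b x" using x(2) edge_V[OF e(2)] by auto
      then have "(v, w) \<in> ?P" using x(1) by blast
      then show "e \<in> (\<lambda>(v, w). {v, w}) ` ?P" using e(1) by (intro image_eqI[of _ _ "(v, w)"]) auto
    qed
    moreover have finP: "finite ?P" using finite_gball[OF z(1)] by blast
    ultimately have "finite (edge_boundary E (A N))"
      "card (edge_boundary E (A N)) \<le> card ((\<lambda>(v, w). {v, w}) ` ?P)"
      using finite_subset[OF _ finite_imageI] by (blast, intro card_mono) auto
    moreover have "card ((\<lambda>(v, w). {v, w}) ` ?P) \<le> card ?P" using finP by (rule card_image_le)
    moreover have "card ?P \<le> card (?b (z 0)) + card (?b (z (Suc N)))" by (rule card_Un_le)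
    moreover have bB: "card (?b (z i)) \<le> B * B" for i
      using growth[OF z(1), of "\<rho> + 1" i] unfolding card_cartesian_product B_def
      by (intro mult_le_mono) auto
    ultimately show ?thesis using bB[of 0] bB[of "Suc N"] by linarith
  qed
  obtain M where M: "\<And>A. finite A \<Longrightarrow> A \<subseteq> V \<Longrightarrow> finite (edge_boundary E A) \<Longrightarrow>
      card (edge_boundary E A) \<le> 2 * (B * B) \<Longrightarrow> card A \<le> M"
    using bounded_boundary[of "2 * (B * B)"] by blast
  have cardA: "card (A N) \<le> M" for N
    using bd[of N] finF F_ball by (intro M) (auto simp: A_def)
  \<comment> \<open>The union of all segments can be left only through the ball at
    \<open>z 0\<close>, so it contains an infinite component outside that ball. Distinctness of the
    chain vertices is thus never an issue.\<close>
  have "{v. joined E (outside (z 0) \<rho>) (z 1) v} \<subseteq> (\<Union>i. F i)"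
  proof
    fix v assume "v \<in> {v. joined E (outside (z 0) \<rho>) (z 1) v}"
    then have "joined E (outside (z 0) \<rho>) (z 1) v" by simp
    then show "v \<in> (\<Union>i. F i)"
    proof (induction rule: joined_induct)
      case refl
      have "z 1 \<in> F 0" using ball_F[of 0] z(1)[of 1] by auto
      then show ?case by blast
    next
      case (step v w)
      then obtain i where i: "v \<in> F i" by blast
      show ?case
      proof (cases "w \<in> F i")
        case False
        from exit[OF i \<open>{v, w} \<in> E\<close> False] show ?thesis
        proof
          assume w: "w \<in> gball (z i) \<rho>"
          then have "i \<noteq> 0" using \<open>w \<in> outside (z 0) \<rho>\<close> by (intro notI) simp
          then show ?thesis using w ball_F[of "i - 1"] by auto
        next
          assume "w \<in> gball (z (Suc (Suc i))) \<rho>"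
          then show ?thesis using ball_F[of "Suc i"] by auto
        qed
      qed blast
    qed
  qed
  moreover have "infinite {v. joined E (outside (z 0) \<rho>) (z 1) v}"
    using z(2)[of 0] \<rho> by (intro no_deep_pocket z) auto
  ultimately have "infinite (\<Union>i. F i)" using finite_subset by blast
  then obtain T where T: "T \<subseteq> (\<Union>i. F i)" "finite T" "card T = Suc M"
    using infinite_arbitrarily_large by blast
  then obtain N where "T \<subseteq> A N" using finite_subset_UN_lessThan[OF T(2,1)] by (auto simp: A_def)
  then have "card T \<le> card (A N)" using finF by (intro card_mono) (auto simp: A_def)
  then show False using cardA[of N] T(3) by simp
qed

text \<open>Radii are fixed from the last use back to the first: \<open>S'\<close> holds
  \<open>n + 1\<close> generations of step \<open>hh\<close>, \<open>S\<close> allows the transfer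
  of a three-armed star, \<open>R\<close> the transfer of the star at \<open>y\<close>, and
  \<open>C\<close> is large enough for \<open>R \<le> C * n * r\<close>. \<open>H\<close> is a depth
  from which the first transfer is possible.\<close>

lemma annulus_connected_step:
  assumes ineq: "C4 + c * (\<kappa> * m + 1) \<le> H"
    "b = c * H + m" "t = c * (\<kappa> * m * b + 1)"
    "C = c * (c * H + c * (2 * (c * t) + m * b + 2 * (c * H) + q + 1) + q + 1)"
    and r: "r \<ge> 1" and n: "n \<ge> 1" "g * (C * n * r) ^ D < 2 ^ n"
    and V: "y \<in> V" "u \<in> V" "v \<in> V"
    and u: "\<kappa> * r < d y u" "d y u \<le> C4 * r" and v: "\<kappa> * r < d y v" "d y v \<le> C4 * r"
  shows "joined E (ann y r (C * n * r)) u v"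
proof (rule ccontr)
  assume nj: "\<not> joined E (ann y r (C * n * r)) u v"
  define h where "h = c * H * r"
  define \<rho> where "\<rho> = m * r"
  define hh where "hh = c * (t * r)"
  define S' where "S' = Suc n * hh + m * (b * r) + 2 * h"
  define S where "S = h + c * (S' + q + 1)"
  define R where "R = c * (S + q + 1)"
  have c1: "c * x \<ge> x" for x using c_pos by simp
  have m1: "m \<ge> 1" using c_pos by (simp add: m_def)
  have \<kappa>3: "\<kappa> \<ge> 3" using c1[of "2 * m + 1"] m1 unfolding \<kappa>_def by linarith
  have n1: "x \<le> n * x" for x using n(1) by simp
  have r1: "x \<le> x * r" for x using r by simp
  have S'_le: "S' \<le> (2 * (c * t) + m * b + 2 * (c * H)) * (n * r)"
  proof -
    have "S' = n * (c * t * r) + c * t * r + m * b * r + 2 * (c * H * r)"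
      by (simp add: S'_def hh_def h_def algebra_simps)
    also have "\<dots> \<le> n * (c * t * r) + n * (c * t * r) + n * (m * b * r) + n * (2 * (c * H * r))"
      by (intro add_mono n1 le_refl)
    also have "\<dots> = (2 * (c * t) + m * b + 2 * (c * H)) * (n * r)" by (simp add: algebra_simps)
    finally show ?thesis .
  qed
  have const: "x \<le> x * (n * r)" for x using order_trans[OF r1 n1, of x] by (simp add: algebra_simps)
  have S_le: "S \<le> (c * H + c * (2 * (c * t) + m * b + 2 * (c * H) + q + 1)) * (n * r)"
  proof -
    have "S' + q + 1 \<le> (2 * (c * t) + m * b + 2 * (c * H) + q + 1) * (n * r)"
      using S'_le const[of "q + 1"] unfolding add_mult_distrib by linarith
    then have "c * (S' + q + 1) \<le> c * ((2 * (c * t) + m * b + 2 * (c * H) + q + 1) * (n * r))"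
      by (rule mult_le_mono2)
    moreover have "h \<le> c * H * (n * r)" using n1[of "c * H * r"] by (simp add: h_def algebra_simps)
    ultimately show ?thesis unfolding S_def by (simp only: add_mult_distrib mult.assoc)
  qed
  have R_le: "R \<le> C * n * r"
  proof -
    have "S + q + 1 \<le> (c * H + c * (2 * (c * t) + m * b + 2 * (c * H) + q + 1) + q + 1) * (n * r)"
      using S_le const[of "q + 1"] unfolding add_mult_distrib by linarith
    then have "R \<le> c * ((c * H + c * (2 * (c * t) + m * b + 2 * (c * H) + q + 1) + q + 1) * (n * r))"
      unfolding R_def by (rule mult_le_mono2)
    then show ?thesis using ineq(4) by (simp only: mult.assoc)
  qed
  have Hr: "C4 * r + c * (\<kappa> * m + 1) * r \<le> H * r"
    using mult_le_mono1[OF ineq(1), of r] by (simp add: add_mult_distrib)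
  have S'S: "S' \<le> S" "S \<le> R" "c * (S' + q + 1) \<le> S - h" "c * (S + q + 1) \<le> R"
    using c1[of "S' + q + 1"] c1[of "S + q + 1"] by (auto simp: S_def R_def)
  have hS': "2 * h \<le> S'" "Suc n * hh \<le> S'" "hh \<le> S'" "hh + m * (b * r) + 2 * h \<le> S'" by (auto simp: S'_def)
  have HR: "H * r \<le> h" using c1[of "H * r"] by (simp add: h_def mult.assoc)
  have \<rho>h: "c * (\<kappa> * m + 1) * r \<le> h" using Hr HR by linarith
  have star_h: "c * (\<kappa> * (m * r) + 1) \<le> c * (\<kappa> * m + 1) * r"
  proof -
    have "\<kappa> * (m * r) + 1 \<le> (\<kappa> * m + 1) * r" using r by simp
    then show ?thesis using mult_le_mono2[of _ _ c] by (simp only: mult.assoc)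
  qed
  have \<kappa>\<rho>: "\<kappa> * \<rho> < h"
    using star_h \<rho>h c1[of "\<kappa> * (m * r) + 1"] unfolding \<rho>_def by linarith
  have \<rho>3: "3 * \<rho> < h"
  proof -
    have "3 * \<rho> \<le> \<kappa> * \<rho>" using \<kappa>3 by (rule mult_le_mono1)
    then show ?thesis using \<kappa>\<rho> by linarith
  qed
  have br: "b * r = h + \<rho>" by (simp add: ineq(2) h_def \<rho>_def algebra_simps)
  have \<rho>1: "\<rho> \<ge> 1" using m1 r by (simp add: \<rho>_def)
  have tr: "c * (\<kappa> * (m * (h + \<rho>)) + 1) \<le> t * r"
  proof -
    have "\<kappa> * (m * (b * r)) + 1 \<le> (\<kappa> * m * b + 1) * r" using r by (simp add: algebra_simps)
    then have "c * (\<kappa> * (m * (b * r)) + 1) \<le> c * ((\<kappa> * m * b + 1) * r)" by (rule mult_le_mono2)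
    then show ?thesis using br ineq(3) by (simp only: mult.assoc)
  qed
  have \<kappa>m: "3 * (m * (h + \<rho>)) < t * r"
  proof -
    have "3 * (m * (h + \<rho>)) \<le> \<kappa> * (m * (h + \<rho>))" using \<kappa>3 by (rule mult_le_mono1)
    then show ?thesis using tr c1[of "\<kappa> * (m * (h + \<rho>)) + 1"] by linarith
  qed
  have mb: "h + \<rho> \<le> m * (h + \<rho>)" using m1 by simp
  have t2: "2 * h \<le> t * r" using \<kappa>m mb by linarith
  have hht: "t * r \<le> hh" using c1 by (simp add: hh_def)
  have tS: "t * r + 3 * h + \<rho> \<le> S"
    using hS'(4) hht mb c1[of "S' + q + 1"] unfolding S_def br by linarith
  have njR: "\<not> joined E (ann y r R) u v"
  proof
    assume "joined E (ann y r R) u v"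
    then have "joined E (ann y r (C * n * r)) u v"
      by (rule joined_mono) (use R_le in auto)
    then show False using nj by simp
  qed
  have njR': "\<not> joined E (ann y r R) v u" using njR joined_sym[of E "ann y r R" v u] by blast
  have C4H: "C4 * r \<le> H * r" using Hr by linarith
  have HR': "H * r \<le> R" using HR hS'(1) S'S by linarith
  have "u \<noteq> v"
  proof
    assume "u = v"
    have "1 * r \<le> \<kappa> * r" by (rule mult_le_mono1) (use \<kappa>3 in linarith)
    then have "r < d y u \<and> d y u \<le> R" using u C4H HR' by linarith
    then have "joined E (ann y r R) u u" using V by (intro joined_refl) auto
    then show False using njR \<open>u = v\<close> by simp
  qed
  then have card2: "card {u, v} = 2" by simp
  have "star (card {u, v}) y r (H * r) R"
  proof (rule starI_slide[OF V(1) r HR'])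
    show "a \<in> V \<and> \<kappa> * r < d y a \<and> d y a \<le> H * r" if "a \<in> {u, v}" for a
      using that V u v order_trans[OF _ C4H] by blast
    show "\<not> joined E (ann y r R) a b" if "a \<in> {u, v}" "b \<in> {u, v}" "a \<noteq> b" for a b
      using that njR njR' by blast
  qed
  then have st_y: "star 2 y r (H * r) R" using card2 by simp
  have st2: "star 2 z \<rho> h S" if z: "z \<in> V" for z
  proof -
    have "star 2 z (m * r) (c * (H * r)) S"
    proof (rule star_transfer[OF st_y V(1) z r])
      show "c * (\<kappa> * (m * r) + 1) \<le> H * r" using star_h Hr by linarith
      show "c * (H * r) \<le> S" using hS'(1) S'S(1) by (simp add: h_def mult.assoc)
    qed (rule S'S)
    then show ?thesis by (simp add: \<rho>_def h_def mult.assoc)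
  qed
  show False
  proof (cases "\<exists>x\<in>V. star 3 x (h + \<rho>) (t * r) (S - h)")
    case True
    then obtain x where x: "x \<in> V" "star 3 x (h + \<rho>) (t * r) (S - h)" by blast
    have st3: "star 3 z (m * (h + \<rho>)) hh S'" if z: "z \<in> V" for z
      unfolding hh_def
    proof (rule star_transfer[OF x(2,1) z _ tr S'S(3)])
      show "h + \<rho> \<ge> 1" using \<rho>1 by simp
      show "c * (t * r) \<le> S'" using hS'(3) by (simp add: hh_def)
    qed
    \<comment> \<open>At the root no direction is excluded: \<open>y\<close> is not in its own
      annulus, so nothing is joined to it there.\<close>
    have "2 ^ n \<le> card {v \<in> V. d y v \<le> Suc n * hh \<and> \<not> joined E (ann y (m * (h + \<rho>)) S') v y}"
    proof (rule branching_growth[OF st3 _ _ V(1) hS'(2)])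
      show "2 * (m * (h + \<rho>)) < hh" using \<kappa>m hht by linarith
      show "hh + m * (h + \<rho>) \<le> S'" using hS'(4) unfolding br by linarith
    qed
    also have "\<dots> \<le> card (gball y (C * n * r))"
    proof (rule card_mono[OF finite_gball[OF V(1)]])
      have "Suc n * hh \<le> C * n * r" using hS'(2) S'S(1,2) R_le by linarith
      then show "{v \<in> V. d y v \<le> Suc n * hh \<and> \<not> joined E (ann y (m * (h + \<rho>)) S') v y}
        \<subseteq> gball y (C * n * r)"
        by fastforce
    qed
    also have "\<dots> \<le> g * (C * n * r) ^ D"
    proof (rule growth[OF V(1)])
      have "R \<ge> 1" using HR \<kappa>\<rho> hS'(1) S'S by linarith
      then show "C * n * r \<ge> 1" using R_le by linarith
    qed
    finally show False using n(2) by simp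
  next
    case False
    then show False using not_linear[OF st2 _ \<rho>1 \<kappa>\<rho> \<rho>3 t2 tS] by blast
  qed
qed

text \<open>Leaving \<open>n\<close> free lets the choice of scales determine it; the hypothesis
  holds for some \<open>n\<close> of order \<open>1 + log r\<close>, the price of a detour.\<close>

theorem annulus_connected:
  obtains C where
    "\<And>r n y u v. r \<ge> 1 \<Longrightarrow> n \<ge> 1 \<Longrightarrow> g * (C * n * r) ^ D < 2 ^ n \<Longrightarrow>
       y \<in> V \<Longrightarrow> u \<in> V \<Longrightarrow> v \<in> V \<Longrightarrow> \<kappa> * r < d y u \<Longrightarrow> d y u \<le> C4 * r \<Longrightarrow>
       \<kappa> * r < d y v \<Longrightarrow> d y v \<le> C4 * r \<Longrightarrow> joined E (ann y r (C * n * r)) u v"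
proof -
  define H where "H = C4 + c * (\<kappa> * m + 1)"
  define b where "b = c * H + m"
  define t where "t = c * (\<kappa> * m * b + 1)"
  define C where "C = c * (c * H + c * (2 * (c * t) + m * b + 2 * (c * H) + q + 1) + q + 1)"
  have "C4 + c * (\<kappa> * m + 1) \<le> H" by (simp add: H_def)
  from annulus_connected_step[OF this b_def t_def C_def] show thesis by (rule that)
qed

end

section \<open>Hierarchically sparse sets of closed vertices\<close>

context inf_graph
begin

text \<open>\<open>fam R k x\<close> lists the possible sets of \<open>2 ^ k\<close> closed vertices witnessing that \<open>x\<close> is bad at
  level \<open>k\<close>. If \<open>x\<close> is not bad at level \<open>k + 1\<close>, the level-\<open>k\<close> bad vertices near it fit into one ball of
  radius \<open>4 * R k\<close>.\<close>

primrec fam :: "(nat \<Rightarrow> nat) \<Rightarrow> nat \<Rightarrow> 'a \<Rightarrow> 'a set set" where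
  "fam R 0 x = {{x}}"
| "fam R (Suc k) x = (\<Union>(y, z) \<in> {(y, z). y \<in> gball x (R (Suc k)) \<and> z \<in> gball x (R (Suc k)) \<and> 4 * R k < d y z}.
     (\<lambda>(T, T'). T \<union> T') ` (fam R k y \<times> fam R k z))"

definition bad :: "(nat \<Rightarrow> nat) \<Rightarrow> 'a set \<Rightarrow> nat \<Rightarrow> 'a \<Rightarrow> bool" where
  "bad R Z k x \<longleftrightarrow> (\<exists>T\<in>fam R k x. T \<subseteq> Z)"

lemma bad_0: "bad R Z 0 x \<longleftrightarrow> x \<in> Z"
  by (simp add: bad_def)

lemma bad_SucI:
  assumes "y \<in> gball x (R (Suc k))" "z \<in> gball x (R (Suc k))" "4 * R k < d y z"
    and "bad R Z k y" "bad R Z k z"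
  shows "bad R Z (Suc k) x"
proof -
  obtain T T' where T: "T \<in> fam R k y" "T \<subseteq> Z" "T' \<in> fam R k z" "T' \<subseteq> Z"
    using assms(4,5) by (auto simp: bad_def)
  have "(y, z) \<in> {(y, z). y \<in> gball x (R (Suc k)) \<and> z \<in> gball x (R (Suc k)) \<and> 4 * R k < d y z}"
    using assms(1-3) by simp
  moreover have "T \<union> T' \<in> (\<lambda>(y, z). (\<lambda>(T, T'). T \<union> T') ` (fam R k y \<times> fam R k z)) (y, z)"
    using T by (auto intro!: image_eqI[of _ _ "(T, T')"])
  ultimately have "T \<union> T' \<in> fam R (Suc k) x" unfolding fam.simps by (rule UN_I)
  then show ?thesis using T unfolding bad_def by (intro bexI[of _ "T \<union> T'"]) auto
qed

lemma fam_Suc_E: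
  assumes "T \<in> fam R (Suc k) x"
  obtains y z T1 T2 where "y \<in> gball x (R (Suc k))" "z \<in> gball x (R (Suc k))" "4 * R k < d y z"
    "T1 \<in> fam R k y" "T2 \<in> fam R k z" "T = T1 \<union> T2"
  using assms by auto

text \<open>A witness stays within \<open>2 * R k\<close> of its centre, so centres more than
  \<open>4 * R k\<close> apart have disjoint witnesses and the cardinality doubles exactly. This is
  the reason for the factor 4 in \<open>fam\<close>.\<close>

lemma fam_props:
  assumes R: "\<And>k. 2 * R k \<le> R (Suc k)" and x: "x \<in> V" "T \<in> fam R k x"
  shows "T \<subseteq> gball x (2 * R k) \<and> finite T \<and> card T = 2 ^ k"
  using x
proof (induction k arbitrary: x T)
  case 0
  then show ?case by simp
next
  case (Suc k)
  from Suc.prems(2) obtain y z T1 T2 where yz: "y \<in> gball x (R (Suc k))" "z \<in> gball x (R (Suc k))"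
    "4 * R k < d y z" "T1 \<in> fam R k y" "T2 \<in> fam R k z" and T: "T = T1 \<union> T2"
    by (rule fam_Suc_E)
  have IH: "T1 \<subseteq> gball y (2 * R k)" "finite T1" "card T1 = 2 ^ k"
    "T2 \<subseteq> gball z (2 * R k)" "finite T2" "card T2 = 2 ^ k"
    using Suc.IH yz by auto
  have "T1 \<inter> T2 = {}"
  proof (rule equals0I)
    fix t assume "t \<in> T1 \<inter> T2"
    then have t: "t \<in> V" "d y t \<le> 2 * R k" "d z t \<le> 2 * R k" using IH by auto
    have "d y z \<le> d y t + d t z" using yz t by (intro dist_triangle) auto
    then show False using t yz(3) by (simp add: dist_sym)
  qed
  then have "card T = 2 ^ Suc k" using IH T by (simp add: card_Un_disjoint)
  moreover have "t \<in> gball x (2 * R (Suc k))"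
    if w: "w \<in> gball x (R (Suc k))" "t \<in> gball w (2 * R k)" for t w
  proof -
    have "d x t \<le> d x w + d w t" using w Suc.prems by (intro dist_triangle) auto
    then show ?thesis using w R[of k] by auto
  qed
  then have "T \<subseteq> gball x (2 * R (Suc k))" using IH(1,4) yz(1,2) T by blast
  ultimately show ?case using IH T by simp
qed

end

context rough_graph
begin

text \<open>A witness at the next level is determined by two centres and one witness at each, whence
  the two squares.\<close>

lemma fam_card:
  assumes B: "\<And>k x. x \<in> V \<Longrightarrow> card (gball x (R k)) \<le> B k"
    and N: "N 0 = 1" "\<And>k. N (Suc k) = (B (Suc k))\<^sup>2 * (N k)\<^sup>2" and x: "x \<in> V"
  shows "finite (fam R k x) \<and> card (fam R k x) \<le> (N k :: nat)"
  using x
proof (induction k arbitrary: x)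
  case 0
  then show ?case using N by simp
next
  case (Suc k)
  let ?b = "gball x (R (Suc k))"
  define P where "P = {(y, z). y \<in> ?b \<and> z \<in> ?b \<and> 4 * R k < d y z}"
  define U where "U = (\<lambda>(y, z). (\<lambda>(T, T'). T \<union> T') ` (fam R k y \<times> fam R k z))"
  have P: "P \<subseteq> ?b \<times> ?b" by (auto simp: P_def)
  have fb: "finite ?b" using finite_gball[OF Suc.prems] .
  then have finP: "finite P" using P finite_subset by blast
  have "card P \<le> card (?b \<times> ?b)" using P fb by (intro card_mono) auto
  also have "\<dots> \<le> B (Suc k) * B (Suc k)"
    unfolding card_cartesian_product by (intro mult_le_mono B Suc.prems)
  finally have cardP: "card P \<le> (B (Suc k))\<^sup>2" by (simp add: power2_eq_square)
  have U: "finite (U p) \<and> card (U p) \<le> (N k)\<^sup>2" if "p \<in> P" for p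
  proof -
    obtain y z where p: "p = (y, z)" "y \<in> V" "z \<in> V" using \<open>p \<in> P\<close> P by auto
    have fin: "finite (fam R k y \<times> fam R k z)" using Suc.IH p by blast
    have "card (U p) \<le> card (fam R k y \<times> fam R k z)"
      unfolding U_def p(1) using card_image_le[OF fin] by simp
    also have "\<dots> \<le> N k * N k"
      unfolding card_cartesian_product using Suc.IH p by (intro mult_le_mono) auto
    finally show ?thesis using fin by (simp add: U_def p(1) power2_eq_square)
  qed
  have eq: "fam R (Suc k) x = (\<Union>p\<in>P. U p)" by (simp add: P_def U_def)
  have "card (\<Union>p\<in>P. U p) \<le> (\<Sum>p\<in>P. card (U p))" using finP by (rule card_UN_le)
  also have "\<dots> \<le> card P * (N k)\<^sup>2" using U sum_bounded_above[of P "\<lambda>p. card (U p)" "(N k)\<^sup>2"] by simp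
  also have "\<dots> \<le> N (Suc k)" unfolding N(2) using cardP by (rule mult_le_mono1)
  finally have "card (\<Union>p\<in>P. U p) \<le> N (Suc k)" .
  moreover have "finite (\<Union>p\<in>P. U p)" using U finP by (intro finite_UN_I) blast+
  ultimately show ?case unfolding eq by blast
qed

section \<open>Rerouting a path around the bad vertices of one level after another\<close>

lemma vertex_at_dist:
  assumes "y \<in> V"
  obtains v where "v \<in> V" "d y v = n"
proof -
  obtain w where w: "w \<in> V" "d y w > n" using far_vertex[OF assms infV subset_refl] by blast
  have yw: "joined E V y w"
    by (rule joined_mono[OF joined_interval[OF assms w(1)]]) auto
  have "d y y \<le> n" by simp
  obtain v where v: "d y v = n" "joined E {w \<in> V. d y w \<le> n} y v"
    by (rule joined_ivt[OF yw subset_refl assms \<open>d y y \<le> n\<close> less_imp_le[OF w(2)]])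
  show thesis using that[OF _ v(1)] joined_in(2)[OF v(2)] by simp
qed

text \<open>The threshold is the pocket depth for balls of radius \<open>4 * R k\<close>, so a clear
  vertex can serve as an end of a detour around any such ball centred at a bad vertex.\<close>

definition clear :: "(nat \<Rightarrow> nat) \<Rightarrow> 'a set \<Rightarrow> nat \<Rightarrow> 'a \<Rightarrow> bool" where
  "clear R Z k w \<longleftrightarrow> (\<forall>b\<in>V. bad R Z k b \<longrightarrow> \<kappa> * (4 * R k) < d w b)"

text \<open>The given path is followed by a shadow that is always clear. Near a vertex not bad at
  level \<open>Suc k\<close>, all level-\<open>k\<close> bad vertices fit into one ball, so one
  annulus takes the shadow past them.\<close>

lemma shadow_step:
  assumes R: "R k \<ge> 1" "(3 * \<kappa> + 1) * (4 * R k) + 1 \<le> R (Suc k)"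
    and ann: "\<And>y u v. y \<in> V \<Longrightarrow> u \<in> V \<Longrightarrow> v \<in> V \<Longrightarrow>
       \<kappa> * (4 * R k) < d y u \<Longrightarrow> d y u \<le> (3 * \<kappa> + 3) * (4 * R k) \<Longrightarrow>
       \<kappa> * (4 * R k) < d y v \<Longrightarrow> d y v \<le> (3 * \<kappa> + 3) * (4 * R k) \<Longrightarrow>
       joined E (ann y (4 * R k) (R (Suc k) - \<kappa> * (4 * R k))) u v"
    and x: "clear R Z k x"
    and j: "joined E {v \<in> V. \<not> bad R Z (Suc k) v} x z"
  obtains w where "joined E {v \<in> V. \<not> bad R Z k v} x w" "d z w \<le> (2 * \<kappa> + 2) * (4 * R k)"
proof -
  define r where "r = 4 * R k"
  define t where "t = (2 * \<kappa> + 2) * r"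
  define G where "G = {v \<in> V. \<not> bad R Z k v}"
  \<comment> \<open>The last clause returns the shadow to the path as soon as the path is clear; the
    distance \<open>t\<close> does not accumulate along the path.\<close>
  define Inv where "Inv v \<longleftrightarrow> (\<exists>w. joined E G x w \<and> clear R Z k w \<and> d v w \<le> t \<and>
    (clear R Z k v \<longrightarrow> w = v))" for v
  have r: "r \<ge> 1" using R(1) by (simp add: r_def)
  have R': "3 * (\<kappa> * r) + r + 1 \<le> R (Suc k)" using R(2) by (simp add: r_def algebra_simps)
  have t_eq: "t = 2 * (\<kappa> * r) + 2 * r" by (simp add: t_def algebra_simps)
  have K3: "(3 * \<kappa> + 3) * (4 * R k) = 3 * (\<kappa> * r) + 3 * r" by (simp add: r_def algebra_simps)
  have clear_far: "\<kappa> * r < d w b" if "clear R Z k w" "b \<in> V" "bad R Z k b" for w b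
    using that by (simp add: clear_def r_def)
  have clear_good: "w \<in> G" if "clear R Z k w" "w \<in> V" for w
    using clear_far[OF that] that(2) by (auto simp: G_def)
  have close: "d y b \<le> r"
    if "v \<in> V" "\<not> bad R Z (Suc k) v" "y \<in> V" "b \<in> V" "bad R Z k y" "bad R Z k b"
      "d v y \<le> R (Suc k)" "d v b \<le> R (Suc k)" for v y b
  proof (rule ccontr)
    assume "\<not> d y b \<le> r"
    then have "bad R Z (Suc k) v"
      using that by (intro bad_SucI[of y v R k b Z]) (auto simp: r_def)
    then show False using that(2) by simp
  qed
  \<comment> \<open>The outer radius is reduced by \<open>\<kappa> * r\<close> because
    \<open>y\<close> may be that far from \<open>v\<close>, and only within \<open>R (Suc k)\<close>
    of \<open>v\<close> are the bad vertices known to lie in the \<open>r\<close>-ball at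
    \<open>y\<close>.\<close>
  have around: "joined E G u u'"
    if v: "v \<in> V" "\<not> bad R Z (Suc k) v" and y: "y \<in> V" "bad R Z k y" "d v y \<le> \<kappa> * r"
      and u: "u \<in> V" "\<kappa> * r < d y u" "d y u \<le> 3 * (\<kappa> * r) + 3 * r"
      and u': "u' \<in> V" "\<kappa> * r < d y u'" "d y u' \<le> 3 * (\<kappa> * r) + 3 * r" for v y u u'
  proof -
    have "joined E (ann y r (R (Suc k) - \<kappa> * r)) u u'"
      using ann[OF y(1) u(1) u'(1)] u(2,3) u'(2,3) unfolding K3 by (simp flip: r_def)
    then show ?thesis
    proof (rule joined_mono)
      show "ann y r (R (Suc k) - \<kappa> * r) \<subseteq> G"
      proof
        fix s assume "s \<in> ann y r (R (Suc k) - \<kappa> * r)"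
        then have s: "s \<in> V" "r < d y s" "d y s \<le> R (Suc k) - \<kappa> * r" by auto
        have "d v s \<le> d v y + d y s" using v y s by (intro dist_triangle) auto
        then have "d v s \<le> R (Suc k)" using s(3) y(3) R' by linarith
        moreover have "d v y \<le> R (Suc k)" using y(3) R' by linarith
        ultimately show "s \<in> G"
          using close[OF v y(1) s(1) y(2)] s(1,2) by (auto simp: G_def)
      qed
    qed
  qed
  have "Inv z"
    using j
  proof (induction rule: joined_induct)
    case refl
    then have "x \<in> V" by simp
    then have "joined E G x x" using clear_good x by (intro joined_refl) auto
    then show ?case using x by (auto simp: Inv_def)
  next
    case (step b e)
    have b: "b \<in> V" "\<not> bad R Z (Suc k) b" and e: "e \<in> V" "\<not> bad R Z (Suc k) e" using step by auto
    from step obtain w where w: "joined E G x w" "clear R Z k w" "d b w \<le> t"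
      "clear R Z k b \<Longrightarrow> w = b" by (auto simp: Inv_def)
    have wV: "w \<in> V" using joined_in(2)[OF w(1)] by (simp add: G_def)
    have be: "d b e \<le> 1" "d e b \<le> 1" using dist_edge[OF \<open>{b, e} \<in> E\<close>] by (auto simp: dist_sym)
    show ?case
    proof (cases "clear R Z k e")
      case ce: True
      have "joined E G x e"
      proof (cases "clear R Z k b")
        case True
        then show ?thesis using w \<open>{b, e} \<in> E\<close> clear_good[OF ce e(1)] joined_step by fast
      next
        case False
        then obtain y where y: "y \<in> V" "bad R Z k y" "d b y \<le> \<kappa> * r"
          by (auto simp: clear_def r_def not_less)
        have "d y w \<le> d y b + d b w" "d y e \<le> d y b + d b e"
          using y b e wV by (auto intro: dist_triangle)
        then have "d y w \<le> 3 * (\<kappa> * r) + 3 * r" "d y e \<le> 3 * (\<kappa> * r) + 3 * r"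
          using y(3) w(3) be r t_eq dist_sym[of y b] by linarith+
        moreover have "\<kappa> * r < d y w" "\<kappa> * r < d y e"
          using clear_far[OF w(2) y(1,2)] clear_far[OF ce y(1,2)] by (auto simp: dist_sym)
        ultimately have "joined E G w e" by (intro around[OF b y wV _ _ e(1)])
        with w(1) show ?thesis by (rule joined_trans)
      qed
      then show ?thesis using ce by (auto simp: Inv_def)
    next
      case False
      then obtain y where y: "y \<in> V" "bad R Z k y" "d e y \<le> \<kappa> * r"
        by (auto simp: clear_def r_def not_less)
      \<comment> \<open>Bad vertices near \<open>e\<close> are within \<open>r\<close> of
        \<open>y\<close>, so this distance makes \<open>v\<close> clear. Adding
        \<open>d e y \<le> \<kappa> * r\<close> gives at most
        \<open>2 * \<kappa> * r + r + 1\<close>, the origin of \<open>t\<close>.\<close>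
      obtain v where v: "v \<in> V" "d y v = \<kappa> * r + r + 1" by (rule vertex_at_dist[OF y(1)])
      have ev: "d e v \<le> d e y + d y v" using e y v by (intro dist_triangle) auto
      have "\<kappa> * r < d v s" if s: "s \<in> V" "bad R Z k s" for s
      proof (rule ccontr)
        assume vs: "\<not> \<kappa> * r < d v s"
        have "d e s \<le> d e v + d v s" "d y v \<le> d y s + d s v"
          by (rule dist_triangle[OF e(1) v(1) s(1)], rule dist_triangle[OF y(1) s(1) v(1)])
        then have "d e s \<le> R (Suc k)" "r < d y s"
          using vs ev v(2) y(3) R' dist_sym[of s v] by linarith+
        moreover have "d e y \<le> R (Suc k)" using y(3) R' by linarith
        ultimately show False using close[OF e y(1) s(1) y(2) s(2)] by simp
      qed
      then have cv: "clear R Z k v" by (simp add: clear_def r_def)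
      have "d y w \<le> d y e + d e w" "d e w \<le> d e b + d b w"
        using y b e wV by (auto intro: dist_triangle)
      then have "d y w \<le> 3 * (\<kappa> * r) + 3 * r"
        using y(3) w(3) be r t_eq dist_sym[of y e] by linarith
      moreover have "\<kappa> * r < d y w" using clear_far[OF w(2) y(1,2)] by (simp add: dist_sym)
      ultimately have "joined E G w v" using v r by (intro around[OF e y wV _ _ v(1)]) auto
      with w(1) have "joined E G x v" by (rule joined_trans)
      moreover have "d e v \<le> t" using ev v(2) y(3) r t_eq by linarith
      ultimately show ?thesis using cv False by (auto simp: Inv_def)
    qed
  qed
  then show thesis using that by (auto simp: Inv_def G_def t_def r_def)
qed

text \<open>Levels are removed from \<open>k\<close> down to 0. As \<open>x\<close> is clear at
  every level, the start stays fixed and only the endpoint moves, each time by a multiple of the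
  current scale.\<close>

lemma shadow:
  assumes R: "\<And>k. R k \<ge> 1" "\<And>k. (3 * \<kappa> + 1) * (4 * R k) + 1 \<le> R (Suc k)"
    and ann: "\<And>k y u v. y \<in> V \<Longrightarrow> u \<in> V \<Longrightarrow> v \<in> V \<Longrightarrow>
       \<kappa> * (4 * R k) < d y u \<Longrightarrow> d y u \<le> (3 * \<kappa> + 3) * (4 * R k) \<Longrightarrow>
       \<kappa> * (4 * R k) < d y v \<Longrightarrow> d y v \<le> (3 * \<kappa> + 3) * (4 * R k) \<Longrightarrow>
       joined E (ann y (4 * R k) (R (Suc k) - \<kappa> * (4 * R k))) u v"
    and x: "\<And>k. clear R Z k x"
    and j: "joined E {v \<in> V. \<not> bad R Z k v} x z"
  shows "\<exists>w. joined E (V - Z) x w \<and> d z w \<le> (\<Sum>j<k. (8 * \<kappa> + 8) * R j)"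
  using j
proof (induction k arbitrary: z)
  case 0
  have "{v \<in> V. \<not> bad R Z 0 v} = V - Z" by (auto simp: bad_0)
  then show ?case using 0 by (intro exI[of _ z]) simp
next
  case (Suc k)
  obtain w where w: "joined E {v \<in> V. \<not> bad R Z k v} x w" "d z w \<le> (2 * \<kappa> + 2) * (4 * R k)"
    by (rule shadow_step[OF R ann x Suc.prems])
  obtain w' where w': "joined E (V - Z) x w'" "d w w' \<le> (\<Sum>j<k. (8 * \<kappa> + 8) * R j)"
    using Suc.IH[OF w(1)] by blast
  have "d z w' \<le> d z w + d w w'"
    using joined_in(2)[OF w(1)] joined_in(2)[OF w'(1)] joined_in(2)[OF Suc.prems]
    by (intro dist_triangle) auto
  moreover have "(2 * \<kappa> + 2) * (4 * R k) = (8 * \<kappa> + 8) * R k" by (simp add: algebra_simps)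
  ultimately have "d z w' \<le> (\<Sum>j<Suc k. (8 * \<kappa> + 8) * R j)"
    using w(2) w'(2) unfolding sum.lessThan_Suc by linarith
  then show ?case using w'(1) by blast
qed

theorem infinite_open_component:
  assumes R: "\<And>k. R k \<ge> 1" "\<And>k. (3 * \<kappa> + 1) * (4 * R k) + 1 \<le> R (Suc k)"
    and ann: "\<And>k y u v. y \<in> V \<Longrightarrow> u \<in> V \<Longrightarrow> v \<in> V \<Longrightarrow>
       \<kappa> * (4 * R k) < d y u \<Longrightarrow> d y u \<le> (3 * \<kappa> + 3) * (4 * R k) \<Longrightarrow>
       \<kappa> * (4 * R k) < d y v \<Longrightarrow> d y v \<le> (3 * \<kappa> + 3) * (4 * R k) \<Longrightarrow>
       joined E (ann y (4 * R k) (R (Suc k) - \<kappa> * (4 * R k))) u v"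
    and x: "x \<in> V" "\<And>k b. b \<in> gball x ((8 * \<kappa> + 9) * R k) \<Longrightarrow> \<not> bad R Z k b"
  shows "infinite {w. joined E (V - Z) x w}"
proof
  assume fin: "finite {w. joined E (V - Z) x w}"
  have cl: "clear R Z k x" for k
    unfolding clear_def
  proof (intro ballI impI)
    fix b assume b: "b \<in> V" "bad R Z k b"
    then have "\<not> d x b \<le> (8 * \<kappa> + 9) * R k" using x(2)[of b k] by auto
    moreover have "\<kappa> * (4 * R k) \<le> (8 * \<kappa> + 9) * R k" by (simp add: algebra_simps)
    ultimately show "\<kappa> * (4 * R k) < d x b" by linarith
  qed
  have R2: "2 * R k \<le> R (Suc k)" for k using R(2)[of k] by (simp add: algebra_simps)
  have sumR: "(\<Sum>j<k. R j) \<le> R k" for k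
  proof (induction k)
    case (Suc k)
    then show ?case using R2[of k] by simp
  qed simp
  have Rk: "k \<le> R k" for k
  proof (induction k)
    case (Suc k)
    then show ?case using R2[of k] R(1)[of k] by linarith
  qed simp
  define M where "M = Max (d x ` {w. joined E (V - Z) x w})"
  have M: "d x w \<le> M" if "joined E (V - Z) x w" for w
    unfolding M_def using fin that by (intro Max_ge) auto
  define k where "k = Suc M"
  \<comment> \<open>This radius exceeds the total displacement, at most
    \<open>(8 * \<kappa> + 8) * R k\<close>, by \<open>R k\<close>; the open path therefore ends at
    distance at least \<open>R k \<ge> k\<close> from \<open>x\<close>.\<close>
  obtain z where z: "z \<in> V" "d x z = (8 * \<kappa> + 9) * R k" by (rule vertex_at_dist[OF x(1)])
  have "joined E {v \<in> V. \<not> bad R Z k v} x z"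
    by (rule joined_mono[OF joined_interval[OF x(1) z(1)]]) (use x(2) z in auto)
  then obtain w where w: "joined E (V - Z) x w" "d z w \<le> (\<Sum>j<k. (8 * \<kappa> + 8) * R j)"
    using shadow[OF R ann cl] by blast
  have "(\<Sum>j<k. (8 * \<kappa> + 8) * R j) \<le> (8 * \<kappa> + 8) * R k"
    unfolding sum_distrib_left[symmetric] using sumR by (rule mult_le_mono2)
  moreover have "(8 * \<kappa> + 9) * R k = (8 * \<kappa> + 8) * R k + R k" by (simp add: algebra_simps)
  moreover have "d x z \<le> d x w + d w z"
    using x(1) z(1) joined_in(2)[OF w(1)] by (intro dist_triangle) auto
  ultimately have "R k \<le> d x w" using w(2) z(2) dist_sym[of w z] by linarith
  then have "k \<le> M" using M[OF w(1)] Rk[of k] by linarith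
  then show False by (simp add: k_def)
qed

end

section \<open>Choice of the scales and counting of witnesses\<close>

lemma four_power_le:
  assumes "16 \<le> (s::nat)"
  shows "s ^ 4 \<le> 2 ^ s"
  using assms
proof (induction s rule: dec_induct)
  case base
  then show ?case by simp
next
  case (step s)
  have "(Suc s) ^ 4 \<le> 2 * s ^ 4"
  proof -
    have "16 * s ^ 3 \<le> s * s ^ 3" "16 * s ^ 2 \<le> s * s ^ 2" "16 * s \<le> s * s" "1 \<le> s"
      using step(1) by (auto intro: mult_le_mono1)
    then have "4 * s ^ 3 + 6 * s ^ 2 + 4 * s + 1 \<le> s ^ 4"
      unfolding power4_eq_xxxx power3_eq_cube power2_eq_square mult.assoc by linarith
    moreover have "(Suc s) ^ 4 = s ^ 4 + (4 * s ^ 3 + 6 * s ^ 2 + 4 * s + 1)"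
      by (simp add: power3_eq_cube power4_eq_xxxx power2_eq_square algebra_simps)
    ultimately show ?thesis by simp
  qed
  then show ?case using step by simp
qed

text \<open>The scales are \<open>2 ^ (k + k0)\<^sup>2\<close>: consecutive ratios tend to infinity fast enough for
  exponential growth to beat polynomial growth within a single step, and yet
  \<open>R (k + 1)\<^sup>2 \<le> R k ^ 3\<close>, so that volumes stay below \<open>Q ^ 2 ^ k\<close> for some \<open>Q\<close>.\<close>

lemma scales_exist:
  fixes \<kappa> C g D :: nat
  obtains R :: "nat \<Rightarrow> nat" where "\<And>k. R k \<ge> 1" "\<And>k. (3 * \<kappa> + 1) * (4 * R k) + 1 \<le> R (Suc k)"
    "\<And>k. (R (Suc k))\<^sup>2 \<le> (R k) ^ 3"
    "\<And>k. \<exists>n\<ge>1. g * (C * n * (4 * R k)) ^ D < 2 ^ n \<and> C * n * (4 * R k) + \<kappa> * (4 * R k) \<le> R (Suc k)"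
proof -
  define s0 where "s0 = 16 + g + 4 * C + 12 * \<kappa> + 5 * D"
  define R where "R k = (2::nat) ^ ((k + s0)\<^sup>2)" for k
  have *: "R k \<ge> 1 \<and> (3 * \<kappa> + 1) * (4 * R k) + 1 \<le> R (Suc k) \<and> (R (Suc k))\<^sup>2 \<le> (R k) ^ 3 \<and>
    (\<exists>n\<ge>1. g * (C * n * (4 * R k)) ^ D < 2 ^ n \<and> C * n * (4 * R k) + \<kappa> * (4 * R k) \<le> R (Suc k))" for k
  proof -
    define s where "s = k + s0"
    have s: "16 \<le> s" "g \<le> s" "4 * C \<le> s" "12 * \<kappa> + 5 \<le> s" "5 * D + 2 \<le> s"
      by (auto simp: s_def s0_def)
    have Rk: "R k = 2 ^ (s\<^sup>2)" by (simp add: R_def s_def)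
    have "(Suc k + s0)\<^sup>2 = s\<^sup>2 + (2 * s + 1)" by (simp add: s_def power2_eq_square algebra_simps)
    then have RS: "R (Suc k) = R k * 2 ^ (2 * s + 1)" by (simp add: R_def s_def power_add)
    have R1: "R k \<ge> 1" by (simp add: Rk)
    have s2: "s \<le> 2 ^ s" by (rule less_imp_le[OF less_exp])
    have p2: "(2::nat) ^ s + 2 ^ s \<le> 2 ^ (2 * s + 1)"
    proof -
      have "(2::nat) ^ s \<le> 2 ^ (2 * s)" by (rule power_increasing) auto
      moreover have "(2::nat) ^ (2 * s + 1) = 2 * 2 ^ (2 * s)" by simp
      ultimately show ?thesis by linarith
    qed
    have a: "(3 * \<kappa> + 1) * (4 * R k) + 1 \<le> R (Suc k)"
    proof -
      have "(3 * \<kappa> + 1) * (4 * R k) + 1 \<le> (12 * \<kappa> + 5) * R k" using R1 by (simp add: algebra_simps)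
      also have "\<dots> \<le> 2 ^ (2 * s + 1) * R k" using s(4) s2 p2 by (intro mult_le_mono1) linarith
      finally show ?thesis unfolding RS by (simp only: mult.commute)
    qed
    have b: "(R (Suc k))\<^sup>2 \<le> (R k) ^ 3"
    proof -
      have lin: "(x + (2 * s + 1)) * 2 \<le> x * 3" if "4 * s + 2 \<le> x" for x using that by simp
      have "4 * s + 2 \<le> 16 * s" using s(1) by linarith
      also have "\<dots> \<le> s\<^sup>2" using mult_le_mono1[OF s(1), of s] by (simp only: power2_eq_square)
      finally have "(s\<^sup>2 + (2 * s + 1)) * 2 \<le> s\<^sup>2 * 3" by (rule lin)
      then have "(2::nat) ^ ((s\<^sup>2 + (2 * s + 1)) * 2) \<le> 2 ^ (s\<^sup>2 * 3)" by (rule power_increasing) simp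
      then show ?thesis unfolding RS Rk power_add[symmetric] power_mult .
    qed
    \<comment> \<open>A cubic \<open>n\<close> beats the exponent of \<open>(R k) ^ D\<close>,
      quadratic in \<open>s\<close>, while \<open>4 * C * n \<le> 2 ^ s\<close> stays well below the
      ratio \<open>2 ^ (2 * s + 1)\<close> of consecutive scales.\<close>
    define n where "n = s ^ 3"
    have Cn: "4 * C * n \<le> 2 ^ s"
    proof -
      have "4 * C * n \<le> s * n" using s(3) by (rule mult_le_mono1)
      also have "\<dots> = s ^ 4" by (simp add: n_def power3_eq_cube power4_eq_xxxx)
      also have "\<dots> \<le> 2 ^ s" using s(1) by (rule four_power_le)
      finally show ?thesis .
    qed
    have c: "C * n * (4 * R k) + \<kappa> * (4 * R k) \<le> R (Suc k)"
    proof -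
      have "C * n * (4 * R k) + \<kappa> * (4 * R k) = (4 * C * n + 4 * \<kappa>) * R k" by (simp add: algebra_simps)
      also have "\<dots> \<le> 2 ^ (2 * s + 1) * R k" using Cn s(4) s2 p2 by (intro mult_le_mono1) linarith
      finally show ?thesis unfolding RS by (simp only: mult.commute)
    qed
    have e: "g * (C * n * (4 * R k)) ^ D < 2 ^ n"
    proof -
      have "C * n * (4 * R k) = (4 * C * n) * R k" by (simp add: algebra_simps)
      also have "\<dots> \<le> 2 ^ s * 2 ^ s\<^sup>2" using Cn unfolding Rk by (rule mult_le_mono1)
      also have "\<dots> = 2 ^ (s + s\<^sup>2)" by (simp add: power_add)
      finally have "(C * n * (4 * R k)) ^ D \<le> (2 ^ (s + s\<^sup>2)) ^ D" by (rule power_mono) simp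
      moreover have "g \<le> 2 ^ s" using s(2) s2 by linarith
      ultimately have "g * (C * n * (4 * R k)) ^ D \<le> 2 ^ s * (2 ^ (s + s\<^sup>2)) ^ D"
        by (intro mult_le_mono)
      also have "\<dots> = 2 ^ (s + (s + s\<^sup>2) * D)" by (simp add: power_add power_mult)
      also have "\<dots> < 2 ^ n"
      proof (rule power_strict_increasing)
        have "s \<le> s\<^sup>2" using s(1) by (simp add: power2_eq_square)
        then have "(s + s\<^sup>2) * D \<le> (2 * s\<^sup>2) * D" by (intro mult_le_mono1) simp
        then have "s + (s + s\<^sup>2) * D \<le> s\<^sup>2 + (2 * s\<^sup>2) * D" using \<open>s \<le> s\<^sup>2\<close> by (rule add_mono[rotated])
        also have "\<dots> = (2 * D + 1) * s\<^sup>2" by (simp add: algebra_simps)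
        also have "\<dots> < s * s\<^sup>2" using s(1,5) by (intro mult_strict_right_mono) auto
        finally show "s + (s + s\<^sup>2) * D < n" by (simp add: n_def power2_eq_square power3_eq_cube)
      qed simp
      finally show ?thesis .
    qed
    have "n \<ge> 1" using s(1) by (simp add: n_def)
    then show ?thesis using R1 a b c e by blast
  qed
  show thesis by (rule that[of R]) (use * in blast)+
qed

text \<open>The product \<open>N k * (B k) ^ 6\<close> is at most squared at each step, since
  \<open>(B (Suc k)) ^ 8 \<le> (B k) ^ 12\<close>. The exponent 6 solves
  \<open>3 * (2 + a) / 2 = 2 * a\<close>.\<close>

lemma tree_count_bound:
  fixes B N :: "nat \<Rightarrow> nat"
  assumes "N 0 = 1" "\<And>k. N (Suc k) = (B (Suc k))\<^sup>2 * (N k)\<^sup>2"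
    and "\<And>k. (B (Suc k))\<^sup>2 \<le> (B k) ^ 3"
  shows "N k * (B k) ^ 6 \<le> ((B 0) ^ 6) ^ (2 ^ k)"
proof (induction k)
  case 0
  then show ?case using assms(1) by simp
next
  case (Suc k)
  have "N (Suc k) * (B (Suc k)) ^ 6 = ((B (Suc k))\<^sup>2) ^ 4 * (N k)\<^sup>2"
    unfolding assms(2) by (simp flip: power_mult power_add add: mult.commute mult.left_commute)
  also have "\<dots> \<le> ((B k) ^ 3) ^ 4 * (N k)\<^sup>2"
    by (intro mult_le_mono1 power_mono assms(3)) simp
  also have "\<dots> = (N k * (B k) ^ 6)\<^sup>2" by (simp add: power_mult_distrib flip: power_mult)
  also have "\<dots> \<le> (((B 0) ^ 6) ^ (2 ^ k))\<^sup>2" by (rule power_mono[OF Suc.IH]) simp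
  also have "\<dots> = ((B 0) ^ 6) ^ (2 ^ Suc k)" by (simp flip: power_mult add: mult.commute)
  finally show ?case .
qed

section \<open>Percolation\<close>

lemma prob_space_site_percolation: "prob_space (site_percolation V p)"
  unfolding site_percolation_def by (intro prob_space_PiM prob_space_measure_pmf)

lemma measure_all_eq:
  assumes T: "finite T" "T \<subseteq> V"
  shows "{\<omega> \<in> space (site_percolation V p). \<forall>t\<in>T. \<omega> t = v} \<in> sets (site_percolation V p)"
    and "measure (site_percolation V p) {\<omega> \<in> space (site_percolation V p). \<forall>t\<in>T. \<omega> t = v}
      = pmf (bernoulli_pmf p) v ^ card T"
proof -
  let ?B = "\<lambda>_::'a. measure_pmf (bernoulli_pmf p)"
  interpret product_prob_space ?B V
    by unfold_locales
  have emb: "{\<omega> \<in> space (site_percolation V p). \<forall>t\<in>T. \<omega> t \<in> A} = prod_emb V ?B T (\<Pi>\<^sub>E t\<in>T. A)" for A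
    unfolding site_percolation_def space_PiM prod_emb_def
    by (rule set_eqI) (simp only: mem_Collect_eq Int_iff vimage_eq restrict_PiE_iff conj_commute)
  have eq: "{\<omega> \<in> space (site_percolation V p). \<forall>t\<in>T. \<omega> t = v} = prod_emb V ?B T (\<Pi>\<^sub>E t\<in>T. {v})"
    using emb[of "{v}"] by (simp only: singleton_iff)
  show "{\<omega> \<in> space (site_percolation V p). \<forall>t\<in>T. \<omega> t = v} \<in> sets (site_percolation V p)"
    unfolding eq unfolding site_percolation_def using T by (intro sets_PiM_I) auto
  show "measure (site_percolation V p) {\<omega> \<in> space (site_percolation V p). \<forall>t\<in>T. \<omega> t = v}
      = pmf (bernoulli_pmf p) v ^ card T"
    unfolding eq unfolding site_percolation_def
    by (subst measure_PiM_emb) (use T in \<open>auto simp: measure_pmf_single\<close>)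
qed

context growth_graph
begin

lemma infinite_cluster_positive:
  "\<exists>p0<1. \<forall>p. p0 < p \<longrightarrow> p \<le> 1 \<longrightarrow>
     measure (site_percolation V p) (infinite_cluster_event V E p) > 0"
proof -
  obtain x where x: "x \<in> V" using infV by fastforce
  obtain C where C:
    "\<And>r n y u v. r \<ge> 1 \<Longrightarrow> n \<ge> 1 \<Longrightarrow> g * (C * n * r) ^ D < 2 ^ n \<Longrightarrow>
       y \<in> V \<Longrightarrow> u \<in> V \<Longrightarrow> v \<in> V \<Longrightarrow> \<kappa> * r < d y u \<Longrightarrow> d y u \<le> (3 * \<kappa> + 3) * r \<Longrightarrow>
       \<kappa> * r < d y v \<Longrightarrow> d y v \<le> (3 * \<kappa> + 3) * r \<Longrightarrow> joined E (ann y r (C * n * r)) u v"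
    using annulus_connected[of "3 * \<kappa> + 3"] by blast
  obtain R :: "nat \<Rightarrow> nat" where R: "\<And>k. R k \<ge> 1" "\<And>k. (3 * \<kappa> + 1) * (4 * R k) + 1 \<le> R (Suc k)"
    "\<And>k. (R (Suc k))\<^sup>2 \<le> (R k) ^ 3"
    "\<And>k. \<exists>n\<ge>1. g * (C * n * (4 * R k)) ^ D < 2 ^ n \<and> C * n * (4 * R k) + \<kappa> * (4 * R k) \<le> R (Suc k)"
    using scales_exist[of \<kappa> g C D] by blast
  have ann: "joined E (ann y (4 * R k) (R (Suc k) - \<kappa> * (4 * R k))) u v"
    if "y \<in> V" "u \<in> V" "v \<in> V"
       "\<kappa> * (4 * R k) < d y u" "d y u \<le> (3 * \<kappa> + 3) * (4 * R k)"
       "\<kappa> * (4 * R k) < d y v" "d y v \<le> (3 * \<kappa> + 3) * (4 * R k)" for k y u v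
  proof -
    obtain n where n: "n \<ge> 1" "g * (C * n * (4 * R k)) ^ D < 2 ^ n"
      "C * n * (4 * R k) + \<kappa> * (4 * R k) \<le> R (Suc k)"
      using R(4) by blast
    have r: "4 * R k \<ge> 1" using R(1)[of k] by linarith
    have "C * n * (4 * R k) \<le> R (Suc k) - \<kappa> * (4 * R k)" using n(3) by linarith
    then have "ann y (4 * R k) (C * n * (4 * R k)) \<subseteq> ann y (4 * R k) (R (Suc k) - \<kappa> * (4 * R k))"
      using order_trans by blast
    with C[OF r n(1,2) that] show ?thesis by (rule joined_mono)
  qed
  have R2: "2 * R k \<le> R (Suc k)" for k using R(2)[of k] by (simp add: algebra_simps)
  define L where "L = 8 * \<kappa> + 9"
  \<comment> \<open>\<open>B k\<close> bounds the number of centres around \<open>x\<close> and, as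
    \<open>R k \<le> L * R k\<close>, also the smaller balls in the count of
    \<open>fam\<close>.\<close>
  define B where "B k = g * (L * R k) ^ D" for k
  define N where "N = rec_nat (1::nat) (\<lambda>k n. (B (Suc k))\<^sup>2 * n\<^sup>2)"
  have N: "N 0 = 1" "\<And>k. N (Suc k) = (B (Suc k))\<^sup>2 * (N k)\<^sup>2" by (simp_all add: N_def)
  have LR: "L * R k \<ge> 1" for k using R(1)[of k] by (simp add: L_def)
  have B_ball: "card (gball y (L * R k)) \<le> B k" if "y \<in> V" for y k
    unfolding B_def using that LR by (rule growth)
  have B_ball': "card (gball y (R k)) \<le> B k" if "y \<in> V" for y k
  proof -
    have "R k \<le> L * R k" by (simp add: L_def)
    then have "card (gball y (R k)) \<le> card (gball y (L * R k))"
      using order_trans[of _ "R k" "L * R k"] by (intro card_mono finite_gball[OF that]) blast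
    then show ?thesis using B_ball[OF that, of k] by linarith
  qed
  have B1: "B k \<ge> 1" for k
  proof -
    have "card (gball x (L * R k)) \<noteq> 0" using finite_gball[OF x] x by (auto simp: card_eq_0_iff)
    then show ?thesis using B_ball[OF x, of k] by linarith
  qed
  have g1: "g \<ge> 1" using B1[of 0] by (cases g) (auto simp: B_def)
  have B_growth: "(B (Suc k))\<^sup>2 \<le> (B k) ^ 3" for k
  proof -
    have "(B (Suc k))\<^sup>2 = g\<^sup>2 * (L\<^sup>2 * (R (Suc k))\<^sup>2) ^ D"
      by (simp add: B_def power_mult_distrib flip: power_mult add: mult.commute)
    also have "\<dots> \<le> g ^ 3 * (L ^ 3 * (R k) ^ 3) ^ D"
      using g1 R(3) by (intro mult_le_mono power_mono power_increasing) (auto simp: L_def)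
    also have "\<dots> = (B k) ^ 3"
      by (simp add: B_def power_mult_distrib flip: power_mult add: mult.commute)
    finally show ?thesis .
  qed
  define Q where "Q = (B 0) ^ 6"
  have Q1: "Q \<ge> 1" using B1[of 0] by (simp add: Q_def)
  have BN: "B k * N k \<le> Q ^ (2 ^ k)" for k
  proof -
    have "B k ^ 1 \<le> B k ^ 6" using B1 by (rule power_increasing[rotated]) simp
    then have "B k * N k \<le> N k * B k ^ 6" by (simp add: mult.commute)
    also have "\<dots> \<le> Q ^ (2 ^ k)"
      unfolding Q_def using N B_growth by (rule tree_count_bound)
    finally show ?thesis .
  qed
  define \<T> where "\<T> k = (\<Union>b\<in>gball x (L * R k). fam R k b)" for k
  have \<T>: "finite (\<T> k)" "card (\<T> k) \<le> Q ^ (2 ^ k)" for k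
  proof -
    have fc: "finite (fam R k b) \<and> card (fam R k b) \<le> N k" if "b \<in> V" for b
      using fam_card[OF B_ball' N that] .
    have fb: "finite (gball x (L * R k))" by (rule finite_gball[OF x])
    show "finite (\<T> k)" unfolding \<T>_def using fb fc by (intro finite_UN_I) auto
    have "card (\<T> k) \<le> (\<Sum>b\<in>gball x (L * R k). card (fam R k b))"
      unfolding \<T>_def using fb by (rule card_UN_le)
    also have "\<dots> \<le> card (gball x (L * R k)) * N k"
      using sum_bounded_above[of "gball x (L * R k)" "\<lambda>b. card (fam R k b)" "N k"] fc by simp
    also have "\<dots> \<le> B k * N k" using B_ball[OF x] by (rule mult_le_mono1)
    finally show "card (\<T> k) \<le> Q ^ (2 ^ k)" using BN[of k] by linarith
  qed
  have \<T>T: "T \<subseteq> V \<and> finite T \<and> card T = 2 ^ k" if "T \<in> \<T> k" for T k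
    using that fam_props[of R, OF R2] unfolding \<T>_def by blast
  \<comment> \<open>Then \<open>Q * (1 - p) < 1 / 4\<close>, so level \<open>k\<close> fails with
    probability at most \<open>(1 / 4) ^ (2 ^ k) \<le> (1 / 4) ^ Suc k\<close>, and these bounds sum
    to \<open>1 / 3\<close>.\<close>
  define p0 where "p0 = 1 - 1 / (4 * real Q)"
  have "measure (site_percolation V p) (infinite_cluster_event V E p) > 0" if p: "p0 < p" "p \<le> 1" for p
  proof -
    let ?M = "site_percolation V p"
    interpret prob_space ?M by (rule prob_space_site_percolation)
    have "1 / (4 * real Q) \<le> 1" using Q1 by (simp add: divide_simps)
    then have p01: "0 \<le> p" "p \<le> 1" using p by (auto simp: p0_def)
    define clo where "clo T = {\<omega> \<in> space ?M. \<forall>t\<in>T. \<omega> t = False}" for T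
    have clo: "clo T \<in> sets ?M" "measure ?M (clo T) = (1 - p) ^ (2 ^ k)" if "T \<in> \<T> k" for T k
      using measure_all_eq[of T V p False] \<T>T[OF that] p01 unfolding clo_def by auto
    define Ev where "Ev k = (\<Union>T\<in>\<T> k. clo T)" for k
    have Ev_sets: "Ev k \<in> sets ?M" for k
      unfolding Ev_def using \<T>(1) clo(1) by (intro sets.finite_UN) auto
    have Ev_le: "measure ?M (Ev k) \<le> (1 / 4) ^ Suc k" for k
    proof -
      have "measure ?M (Ev k) \<le> (\<Sum>T\<in>\<T> k. measure ?M (clo T))"
        unfolding Ev_def using \<T>(1) clo(1) by (intro finite_measure_subadditive_finite) auto
      also have "\<dots> = real (card (\<T> k)) * (1 - p) ^ (2 ^ k)" using clo(2) by simp
      also have "\<dots> \<le> real (Q ^ (2 ^ k)) * (1 - p) ^ (2 ^ k)"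
        using \<T>(2) p01 by (intro mult_right_mono) (auto simp only: of_nat_le_iff zero_le_power)
      also have "\<dots> = (real Q * (1 - p)) ^ (2 ^ k)" by (simp add: power_mult_distrib)
      also have "\<dots> \<le> (1 / 4) ^ (2 ^ k)"
        using p01 p(1) Q1 by (intro power_mono) (auto simp: p0_def field_simps)
      also have "\<dots> \<le> (1 / 4) ^ Suc k"
        by (rule power_decreasing[OF Suc_leI[OF less_exp]]) auto
      finally show ?thesis .
    qed
    have geo: "(\<lambda>k. (1 / 4 :: real) ^ Suc k) sums (1 / 3)"
      using sums_mult[OF geometric_sums[of "1 / 4 :: real"], of "1 / 4"] by simp
    have summ: "summable (\<lambda>k. measure ?M (Ev k))"
      using Ev_le by (intro summable_comparison_test[OF _ sums_summable[OF geo]]) (auto intro!: exI[of _ 0])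
    have "measure ?M (\<Union>k. Ev k) \<le> (\<Sum>k. measure ?M (Ev k))"
      using Ev_sets summ by (intro finite_measure_subadditive_countably) auto
    also have "\<dots> \<le> 1 / 3"
      using suminf_le[OF Ev_le summ sums_summable[OF geo]] sums_unique[OF geo] by simp
    finally have small: "measure ?M (\<Union>k. Ev k) \<le> 1 / 3" .
    have sub: "space ?M - (\<Union>k. Ev k) \<subseteq> infinite_cluster_event V E p"
    proof
      fix \<omega> assume \<omega>: "\<omega> \<in> space ?M - (\<Union>k. Ev k)"
      define Z where "Z = {v \<in> V. \<not> \<omega> v}"
      have VZ: "V - Z = open_vertices V \<omega>" by (auto simp: Z_def open_vertices_def)
      have good: "\<not> bad R Z k b" if b: "b \<in> gball x ((8 * \<kappa> + 9) * R k)" for k b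
      proof
        assume "bad R Z k b"
        then obtain T where T: "T \<in> fam R k b" "T \<subseteq> Z" by (auto simp: bad_def)
        then have "T \<in> \<T> k" using b unfolding \<T>_def L_def by blast
        moreover have "\<omega> \<in> clo T" using \<omega> T(2) by (auto simp: clo_def Z_def)
        ultimately show False using \<omega> by (auto simp: Ev_def)
      qed
      have inf: "infinite {w. joined E (V - Z) x w}"
        using R(1,2) ann x good by (rule infinite_open_component)
      have xo: "x \<in> open_vertices V \<omega>"
      proof (rule ccontr)
        assume "x \<notin> open_vertices V \<omega>"
        then have "{w. joined E (V - Z) x w} = {}" using joined_in(1) by (fastforce simp: VZ)
        then show False using inf by simp
      qed
      have "{w. joined E (V - Z) x w} =
        {y \<in> open_vertices V \<omega>. (x, y) \<in> (adj (induced_edges E (open_vertices V \<omega>)))\<^sup>*}"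
        using joined_in(2)[of E "V - Z" x] xo unfolding VZ by (auto simp: joined_def)
      then have "{w. joined E (V - Z) x w} \<in> clusters V E \<omega>"
        using xo unfolding clusters_def components_of_def by blast
      then show "\<omega> \<in> infinite_cluster_event V E p"
        using inf \<omega> unfolding infinite_cluster_event_def by blast
    qed
    have countV: "countable V"
    proof (rule countable_subset)
      show "V \<subseteq> (\<Union>n. gball x n)" by auto
      show "countable (\<Union>n. gball x n)"
        by (rule countable_UN) (simp_all add: countable_finite finite_gball[OF x])
    qed
    have "2 / 3 \<le> measure ?M (space ?M - (\<Union>k. Ev k))"
      using small Ev_sets by (subst prob_compl) auto
    also have "\<dots> \<le> measure ?M (infinite_cluster_event V E p)"
      using sub infinite_cluster_event_measurable[OF countV] by (rule finite_measure_mono)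
    finally show ?thesis by simp
  qed
  moreover have "p0 < 1" using Q1 by (simp add: p0_def)
  ultimately show ?thesis by blast
qed

end

section \<open>From positive probability to the critical probability\<close>

lemma infinite_cluster_event_null:
  assumes "countable V"
  shows "measure (site_percolation V 0) (infinite_cluster_event V E 0) = 0"
proof -
  let ?M = "site_percolation V 0"
  interpret prob_space ?M by (rule prob_space_site_percolation)
  define op where "op v = {\<omega> \<in> space ?M. \<forall>t\<in>{v}. \<omega> t = True}" for v
  have "op v \<in> null_sets ?M" if "v \<in> V" for v
    using measure_all_eq[of "{v}" V 0 True] that
    unfolding op_def by (auto simp: null_sets_def emeasure_eq_measure)
  then have null: "(\<Union>v\<in>V. op v) \<in> null_sets ?M" using assms by (intro null_sets_UN') auto
  have "infinite_cluster_event V E 0 \<subseteq> (\<Union>v\<in>V. op v)"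
  proof
    fix \<omega> assume "\<omega> \<in> infinite_cluster_event V E 0"
    then obtain K where K: "\<omega> \<in> space ?M" "K \<in> clusters V E \<omega>" "infinite K"
      unfolding infinite_cluster_event_def by blast
    then have "K \<subseteq> open_vertices V \<omega>" by (auto simp: clusters_def components_of_def)
    moreover have "K \<noteq> {}" using K(3) by auto
    ultimately show "\<omega> \<in> (\<Union>v\<in>V. op v)" using K(1) by (auto simp: op_def open_vertices_def)
  qed
  then have "measure ?M (infinite_cluster_event V E 0) \<le> measure ?M (\<Union>v\<in>V. op v)"
    using null by (intro finite_measure_mono) auto
  also have "\<dots> = 0" using null by (rule measure_eq_0_null_sets)
  finally show ?thesis by (simp add: measure_le_0_iff)
qed

text \<open>For \<open>d > 1\<close> the exponent \<open>(d - 1) / d\<close> is positive, so the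
  inequality can be solved for \<open>card A\<close>.\<close>

lemma isoperimetric_bounded:
  assumes iso: "isoperimetric V E c d" and c: "c > 0" and d: "d > 1"
  shows "\<exists>M::nat. \<forall>A. finite A \<longrightarrow> A \<subseteq> V \<longrightarrow> finite (edge_boundary E A) \<longrightarrow>
      card (edge_boundary E A) \<le> (K::nat) \<longrightarrow> card A \<le> M"
proof (intro exI allI impI)
  fix A assume A: "finite A" "A \<subseteq> V" "finite (edge_boundary E A)" "card (edge_boundary E A) \<le> K"
  let ?a = "(d - 1) / d"
  have a: "?a > 0" using d by simp
  have "c * real (card A) powr ?a \<le> real (card (edge_boundary E A))"
    using iso A unfolding isoperimetric_def by blast
  also have "\<dots> \<le> real K" using A(4) by simp
  finally have "real (card A) powr ?a \<le> real K / c" using c by (simp add: field_simps)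
  then have "(real (card A) powr ?a) powr (1 / ?a) \<le> (real K / c) powr (1 / ?a)"
    using a d by (intro powr_mono2) auto
  then have "real (card A) \<le> (real K / c) powr (1 / ?a)" using a d by (simp add: powr_powr)
  then show "card A \<le> nat \<lceil>(real K / c) powr (1 / ?a)\<rceil>" by linarith
qed

theorem theorem1p5:
  fixes V :: "'a set" and E :: "'a set set" and c_i d_i :: real
  assumes "simple_graph V E"
    and "infinite V"
    and "connected_graph V E"
    and "roughly_transitive V E"
    and "polynomial_growth V E"
    and "c_i > 0" and "d_i > 1"
    and "isoperimetric V E c_i d_i"
  shows "critical_prob V E < 1"
proof -
  interpret simple_graph V E by fact
  interpret inf_graph V E by unfold_locales fact+
  obtain c where c: "c \<ge> 1" "roughly_transitive_with c V E"
    using assms(4) by (auto simp: roughly_transitive_def)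
  obtain cu du where cu: "cu > 0" "du > 0"
    "\<And>x r. x \<in> V \<Longrightarrow> r \<ge> 1 \<Longrightarrow> finite (graph_ball V E x r) \<and>
       real (card (graph_ball V E x r)) \<le> cu * r powr du"
    using assms(5) unfolding polynomial_growth_def by blast
  have ball: "graph_ball V E x (real r) = gball x r" for x r by (simp add: graph_ball_def)
  \<comment> \<open>Growth is assumed for radii at least 1; passing to \<open>Suc r\<close> covers
    radius 0.\<close>
  have fin: "finite (gball x r)" if "x \<in> V" for x r
  proof (rule finite_subset)
    show "gball x r \<subseteq> gball x (Suc r)" by auto
    show "finite (gball x (Suc r))" using cu(3)[OF that, of "real (Suc r)"] unfolding ball by simp
  qed
  \<comment> \<open>Rounding \<open>c\<close> up only weakens the conditions on a rough
    isometry.\<close>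
  have rough: "\<exists>\<phi>. rough_map (nat \<lceil>c\<rceil>) \<phi> \<and> \<phi> x = y" if xy: "x \<in> V" "y \<in> V" for x y
  proof -
    obtain \<phi> where \<phi>: "rough_isometry c V E V E \<phi>" "\<phi> x = y"
      using c(2) xy unfolding roughly_transitive_with_def by blast
    have cn: "c \<le> real (nat \<lceil>c\<rceil>)" using c(1) by linarith
    have 1: "d a b < nat \<lceil>c\<rceil> * (d (\<phi> a) (\<phi> b) + 1)" and 2: "d (\<phi> a) (\<phi> b) \<le> nat \<lceil>c\<rceil> * d a b"
      if "a \<in> V" "b \<in> V" for a b
    proof -
      have iso: "1 / c * real (d a b) - 1 < real (d (\<phi> a) (\<phi> b))"
        "real (d (\<phi> a) (\<phi> b)) \<le> c * real (d a b)"
        using \<phi>(1) that unfolding rough_isometry_def by blast+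
      have "real (d a b) < c * real (d (\<phi> a) (\<phi> b) + 1)" using iso(1) c(1) by (simp add: field_simps)
      also have "\<dots> \<le> real (nat \<lceil>c\<rceil>) * real (d (\<phi> a) (\<phi> b) + 1)" using cn by (rule mult_right_mono) simp
      finally show "d a b < nat \<lceil>c\<rceil> * (d (\<phi> a) (\<phi> b) + 1)" by (simp only: of_nat_mult[symmetric] of_nat_less_iff)
      note iso(2)
      also have "c * real (d a b) \<le> real (nat \<lceil>c\<rceil>) * real (d a b)" using cn by (rule mult_right_mono) simp
      finally show "d (\<phi> a) (\<phi> b) \<le> nat \<lceil>c\<rceil> * d a b" by (simp only: of_nat_mult[symmetric] of_nat_le_iff)
    qed
    have "\<exists>a\<in>V. d (\<phi> a) b \<le> nat \<lceil>c\<rceil>" if b: "b \<in> V" for b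
    proof -
      obtain a where "a \<in> V" "real (d (\<phi> a) b) \<le> c"
        using \<phi>(1) b unfolding rough_isometry_def by blast
      then show ?thesis using cn by (intro bexI[of _ a]) linarith+
    qed
    moreover have "\<phi> \<in> V \<rightarrow> V" using \<phi>(1) unfolding rough_isometry_def by blast
    ultimately have "rough_map (nat \<lceil>c\<rceil>) \<phi>" using 1 2 unfolding rough_map_def by blast
    then show ?thesis using \<phi>(2) by blast
  qed
  have grow: "card (gball x r) \<le> nat \<lceil>cu\<rceil> * r ^ nat \<lceil>du\<rceil>" if "x \<in> V" "r \<ge> 1" for x r
  proof -
    have r: "real r \<ge> 1" using that(2) by simp
    have "real (card (gball x r)) \<le> cu * real r powr du"
      using cu(3)[OF that(1) r] unfolding ball by simp
    also have "\<dots> \<le> real (nat \<lceil>cu\<rceil>) * real r powr real (nat \<lceil>du\<rceil>)"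
      using r cu(1,2) by (intro mult_mono powr_mono) (auto simp: le_of_int_ceiling)
    also have "\<dots> = real (nat \<lceil>cu\<rceil> * r ^ nat \<lceil>du\<rceil>)" using that(2) by (simp add: powr_realpow)
    finally show ?thesis by (simp only: of_nat_le_iff)
  qed
  interpret growth_graph V E "nat \<lceil>c\<rceil>" "nat \<lceil>cu\<rceil>" "nat \<lceil>du\<rceil>"
  proof unfold_locales
    show "nat \<lceil>c\<rceil> \<ge> 1" using c(1) by linarith
  qed (use rough fin grow isoperimetric_bounded[OF assms(8,6,7)] in blast)+
  obtain p0 where p0: "p0 < 1" "\<And>p. p0 < p \<Longrightarrow> p \<le> 1 \<Longrightarrow>
     measure (site_percolation V p) (infinite_cluster_event V E p) > 0"
    using infinite_cluster_positive by blast
  have "critical_prob V E \<le> p0"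
    unfolding critical_prob_def
  proof (rule cSup_least)
    \<comment> \<open>An upper bound of the set bounds its supremum only if the set is nonempty;
      \<open>p = 0\<close> is a member.\<close>
    have "countable V" using assms(3,5) by (rule connected_polynomial_growth_countable)
    then have "measure (site_percolation V 0) (infinite_cluster_event V E 0) = 0"
      by (rule infinite_cluster_event_null)
    then show "{p \<in> {0..1}. measure (site_percolation V p) (infinite_cluster_event V E p) = 0} \<noteq> {}"
      by (intro ex_in_conv[THEN iffD1] exI[of _ 0]) simp
  next
    fix p assume "p \<in> {p \<in> {0..1}. measure (site_percolation V p) (infinite_cluster_event V E p) = 0}"
    then show "p \<le> p0" using p0(2)[of p] by (intro leI notI) auto
  qed
  then show ?thesis using p0(1) by linarith
qed

end
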